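(* Let $m\ge 3$ be an integer, and put $n=\left\lceil\frac{1+\sqrt{8m}}{2}\right\rceil$ and $s=m-\binom{n-1}{2}$. Let $G$ be a connected simple graph (of any order) with exactly $m$ edges. If $\max\{\frac{n-6}{2},1\}\le s\le n-1$, then $\rho(G)\ge\rho(P_{n,s+1})$, with equality if and only if $G\cong P_{n,s+1}$.
   Context: All graphs are finite and simple. For a connected graph $G$, the distance matrix is $D(G)=(d_G(u,v))_{u,v\in V(G)}$, where $d_G(u,v)$ is the length of a shortest path between $u$ and $v$; the distance spectral radius $\rho(G)$ is the largest eigenvalue of $D(G)$. $P_k$ is the path on $k$ vertices, $\overline{H}$ is the complement of a graph $H$, $\cup$ denotes disjoint union, and $kH$ is the disjoint union of $k$ copies of $H$. For integers $n\ge 2$ and $1\le c\le n$, $$P_{n,c}=\overline{\left(c+c\lfloor\tfrac{n}{c}\rfloor-n\right)P_{\lfloor n/c\rfloor}\cup\left(n-c\lfloor\tfrac{n}{c}\rfloor\right)P_{\lceil n/c\rceil}},$$ i.e., the complement of the disjoint union of $c$ paths on $n$ vertices in total whose orders differ pairwise by at most $1$. (In particular $P_{n,n}=K_n$.) The number $n$ in the statement is the unique positive integer with $\binom{n-1}{2}<m\le\binom{n}{2}$, so that $1\le s\le n-1$. *)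

theory Defs
  imports
    Complex_Main
    "Graph_Theory.Graph_Theory"
    "Jordan_Normal_Form.Spectral_Radius"
begin

text \<open>
  A finite simple graph is a \<open>'a pair_pre_digraph\<close> satisfying \<open>pair_graph\<close>: a finite vertex set
  with a symmetric, irreflexive set of ordered pairs. Each edge is thus represented by two
  opposite arcs, so that edges are counted as unordered pairs.
\<close>

definition edges :: "'a pair_pre_digraph \<Rightarrow> 'a set set" where
  "edges G = (\<lambda>(u, v). {u, v}) ` parcs G"

text \<open>
  The value is meaningful only if some path joins \<open>u\<close> and \<open>v\<close>, hence for all vertices of a
  connected graph. Paths are arc lists, whose length is the number of edges.
\<close>

definition graph_dist :: "'a pair_pre_digraph \<Rightarrow> 'a \<Rightarrow> 'a \<Rightarrow> nat" where
  "graph_dist G u v = (LEAST k. \<exists>p. pre_digraph.apath (with_proj G) u p v \<and> length p = k)"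

definition distance_matrix_wrt :: "'a pair_pre_digraph \<Rightarrow> 'a list \<Rightarrow> real mat" where
  "distance_matrix_wrt G vs =
     mat (length vs) (length vs) (\<lambda>(i, j). real (graph_dist G (vs ! i) (vs ! j)))"

text \<open>
  Rows and columns of library matrices are numbered, so the vertices have to be enumerated. By
  lemma \<open>eigenvalue_distance_matrix_wrt\<close> below the eigenvalues do not depend on the enumeration.
\<close>

definition distance_matrix :: "'a pair_pre_digraph \<Rightarrow> real mat" where
  "distance_matrix G = distance_matrix_wrt G (SOME vs. distinct vs \<and> set vs = pverts G)"

definition distance_spectral_radius :: "'a pair_pre_digraph \<Rightarrow> real" where
  "distance_spectral_radius G = Max (spectrum (distance_matrix G))"

definition path_graph :: "nat \<Rightarrow> nat pair_pre_digraph" where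
  "path_graph k = \<lparr>pverts = {..<k}, parcs = {(i, j). i < k \<and> j < k \<and> (j = Suc i \<or> i = Suc j)}\<rparr>"

definition graph_complement :: "'a pair_pre_digraph \<Rightarrow> 'a pair_pre_digraph" where
  "graph_complement H = \<lparr>pverts = pverts H,
     parcs = {(u, v). u \<in> pverts H \<and> v \<in> pverts H \<and> u \<noteq> v \<and> (u, v) \<notin> parcs H}\<rparr>"

definition disjoint_union ::
    "'a pair_pre_digraph \<Rightarrow> 'b pair_pre_digraph \<Rightarrow> ('a + 'b) pair_pre_digraph" where
  "disjoint_union G H = \<lparr>pverts = pverts G <+> pverts H,
     parcs = (\<lambda>(u, v). (Inl u, Inl v)) ` parcs G \<union> (\<lambda>(u, v). (Inr u, Inr v)) ` parcs H\<rparr>"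

definition graph_copies :: "nat \<Rightarrow> 'a pair_pre_digraph \<Rightarrow> (nat \<times> 'a) pair_pre_digraph" where
  "graph_copies k H = \<lparr>pverts = {..<k} \<times> pverts H,
     parcs = {((i, u), (j, v)). i < k \<and> i = j \<and> (u, v) \<in> parcs H}\<rparr>"

text \<open>
  For \<open>1 \<le> c \<le> n\<close> neither subtraction of natural numbers truncates, since
  \<open>c * (n div c) \<le> n < c + c * (n div c)\<close>.
\<close>

definition P_graph :: "nat \<Rightarrow> nat \<Rightarrow> (nat \<times> nat + nat \<times> nat) pair_pre_digraph" where
  "P_graph n c = graph_complement (disjoint_union
     (graph_copies (c + c * (n div c) - n) (path_graph (n div c)))
     (graph_copies (n - c * (n div c)) (path_graph (nat \<lceil>real n / real c\<rceil>))))"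

lemma eigenvalue_distance_matrix_wrt:
  assumes "distinct vs" "set vs = pverts G"
  shows "eigenvalue (distance_matrix_wrt G vs) k \<longleftrightarrow>
    (\<exists>f :: 'a \<Rightarrow> real. (\<exists>v\<in>pverts G. f v \<noteq> 0) \<and>
      (\<forall>u\<in>pverts G. (\<Sum>v\<in>pverts G. real (graph_dist G u v) * f v) = k * f u))"
proof -
  define n where "n = length vs"
  define A where "A = distance_matrix_wrt G vs"
  have bij: "bij_betw (\<lambda>i. vs ! i) {0..<n} (pverts G)"
    using assms by (intro bij_betw_nth) (auto simp: n_def)
  have A: "A \<in> carrier_mat n n" by (simp add: A_def distance_matrix_wrt_def n_def)
  have mult: "(A *\<^sub>v vec n (\<lambda>i. f (vs ! i))) $ i =
      (\<Sum>v\<in>pverts G. real (graph_dist G (vs ! i) v) * f v)" if "i < n" for f :: "'a \<Rightarrow> real" and i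
    by (subst sum.reindex_bij_betw[OF bij, symmetric])
      (use that in \<open>simp add: A_def distance_matrix_wrt_def n_def scalar_prod_def\<close>)
  have all: "(\<forall>u\<in>pverts G. Q u) \<longleftrightarrow> (\<forall>i<n. Q (vs ! i))" for Q
    unfolding assms(2)[symmetric] n_def by (metis in_set_conv_nth)
  have ex: "(\<exists>u\<in>pverts G. Q u) \<longleftrightarrow> (\<exists>i<n. Q (vs ! i))" for Q
    unfolding assms(2)[symmetric] n_def by (metis in_set_conv_nth)
  have ev: "eigenvector A (vec n (\<lambda>i. f (vs ! i))) k \<longleftrightarrow> (\<exists>v\<in>pverts G. f v \<noteq> 0) \<and>
      (\<forall>u\<in>pverts G. (\<Sum>v\<in>pverts G. real (graph_dist G u v) * f v) = k * f u)"
    for f :: "'a \<Rightarrow> real"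
  proof -
    let ?x = "vec n (\<lambda>i. f (vs ! i))"
    have "A *\<^sub>v ?x = k \<cdot>\<^sub>v ?x \<longleftrightarrow> (\<forall>i<n. (A *\<^sub>v ?x) $ i = k * f (vs ! i))"
    proof
      assume eq: "A *\<^sub>v ?x = k \<cdot>\<^sub>v ?x"
      show "\<forall>i<n. (A *\<^sub>v ?x) $ i = k * f (vs ! i)" unfolding eq by simp
    next
      assume eq: "\<forall>i<n. (A *\<^sub>v ?x) $ i = k * f (vs ! i)"
      show "A *\<^sub>v ?x = k \<cdot>\<^sub>v ?x"
      proof (rule eq_vecI)
        fix i assume "i < dim_vec (k \<cdot>\<^sub>v ?x)"
        then have "i < n" by simp
        with eq show "(A *\<^sub>v ?x) $ i = (k \<cdot>\<^sub>v ?x) $ i"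
          by (metis dim_vec index_smult_vec(1) index_vec)
      qed (use A in simp)
    qed
    also have "\<dots> \<longleftrightarrow>
        (\<forall>i<n. (\<Sum>v\<in>pverts G. real (graph_dist G (vs ! i) v) * f v) = k * f (vs ! i))"
      by (simp only: mult cong: conj_cong imp_cong)
    finally have 1: "A *\<^sub>v ?x = k \<cdot>\<^sub>v ?x \<longleftrightarrow>
        (\<forall>u\<in>pverts G. (\<Sum>v\<in>pverts G. real (graph_dist G u v) * f v) = k * f u)"
      by (simp only: all)
    have "?x = 0\<^sub>v n \<longleftrightarrow> (\<forall>i<n. f (vs ! i) = 0)"
      by (metis (mono_tags, lifting) dim_vec eq_vecI index_vec index_zero_vec)
    then have 2: "?x \<noteq> 0\<^sub>v n \<longleftrightarrow> (\<exists>v\<in>pverts G. f v \<noteq> 0)"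
      by (simp only: ex) blast
    have "dim_row A = n" using A by blast
    with 1 2 show ?thesis unfolding eigenvector_def by simp
  qed
  show ?thesis
  proof
    assume "eigenvalue (distance_matrix_wrt G vs) k"
    then obtain x where x: "eigenvector A x k" unfolding eigenvalue_def A_def ..
    define f where "f = (\<lambda>u. x $ the_inv_into {0..<n} (\<lambda>i. vs ! i) u)"
    have "x = vec n (\<lambda>i. f (vs ! i))"
    proof (rule eq_vecI)
      fix i assume "i < dim_vec (vec n (\<lambda>i. f (vs ! i)))"
      then have "i \<in> {0..<n}" by simp
      then have "the_inv_into {0..<n} (\<lambda>i. vs ! i) (vs ! i) = i"
        by (intro the_inv_into_f_f) (use bij in \<open>auto simp only: bij_betw_def\<close>)
      with \<open>i \<in> {0..<n}\<close> show "x $ i = vec n (\<lambda>i. f (vs ! i)) $ i" by (simp add: f_def)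
    next
      show "dim_vec x = dim_vec (vec n (\<lambda>i. f (vs ! i)))"
        using x A by (auto simp: eigenvector_def)
    qed
    with x have "eigenvector A (vec n (\<lambda>i. f (vs ! i))) k" by (rule subst[rotated])
    then show "\<exists>f :: 'a \<Rightarrow> real. (\<exists>v\<in>pverts G. f v \<noteq> 0) \<and>
      (\<forall>u\<in>pverts G. (\<Sum>v\<in>pverts G. real (graph_dist G u v) * f v) = k * f u)"
      unfolding ev by (intro exI[of _ f])
  next
    assume "\<exists>f :: 'a \<Rightarrow> real. (\<exists>v\<in>pverts G. f v \<noteq> 0) \<and>
      (\<forall>u\<in>pverts G. (\<Sum>v\<in>pverts G. real (graph_dist G u v) * f v) = k * f u)"
    then obtain f where "eigenvector A (vec n (\<lambda>i. f (vs ! i))) k" unfolding ev by (rule exE)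
    then show "eigenvalue (distance_matrix_wrt G vs) k"
      unfolding eigenvalue_def A_def[symmetric] ..
  qed
qed

end

theory Submission
  imports Defs "HOL-Analysis.Function_Topology"
begin

text \<open>
  Put \<open>c = s + 1\<close>, so that \<open>P\<^bsub>n,c\<^esub>\<close> has exactly \<open>m\<close> edges, and let \<open>H\<close> be the complement of \<open>G\<close>.
  Since non-adjacent vertices are at distance at least \<open>2\<close>, the distance matrix satisfies
  \<open>D(G) \<ge> J - I + A(H)\<close> entrywise, with equality if the diameter is at most \<open>2\<close>, as it is for
  \<open>P\<^bsub>n,c\<^esub>\<close>. A connected graph with \<open>m\<close> edges has at least \<open>n\<close> vertices. If it has more, then
  so many pairs are at distance at least \<open>2\<close> that the average row sum of \<open>D(G)\<close> already exceeds
  \<open>n + 1\<close>, whereas \<open>\<rho>(P\<^bsub>n,c\<^esub>) \<le> n + 1\<close>. So the problem is to minimise the largest eigenvalue of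
  \<open>J + A(H)\<close> over graphs \<open>H\<close> with \<open>n\<close> vertices and \<open>n - c\<close> edges, where \<open>n \<le> 2 c + 4\<close>.

  For a union \<open>H\<close> of paths the eigenvector of \<open>J + A(H)\<close> for the eigenvalue \<open>x\<close>, scaled to have entry sum
  \<open>1\<close>, solves \<open>(x - A(H)) y = 1\<close> on each path separately. Hence \<open>x\<close> is determined by a secular equation:
  the sum of the numbers \<open>T\<^sub>k(x) = 1\<^sup>T (x - A(P\<^sub>k))\<^sup>-\<^sup>1 1\<close>, one for each path \<open>P\<^sub>k\<close>, is \<open>1\<close>. Only orders
  \<open>k \<le> 4\<close> occur, as \<open>n \<le> 4 c\<close>, and the solution of the equation gives
  \<open>\<rho>(P\<^bsub>n,c\<^esub>) = x - 1\<close> (lemmas \<open>secular_root\<close> and \<open>distance_spectral_radius_P_graph\<close>).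

  For arbitrary \<open>H\<close> on \<open>n\<close> vertices the Rayleigh quotient is tested with a vector \<open>\<alpha> + \<beta> d\<close> that is
  affine in the degrees \<open>d\<close> of \<open>H\<close> and agrees, up to a scalar and small errors, with the eigenvector of
  the extremal graph. Its quadratic form depends only on the numbers of walks of length at most \<open>3\<close> in \<open>H\<close>, that
  is, on \<open>\<Sum> d(v)\<close>, on \<open>\<Sum> d(v)\<^sup>2\<close> and on the sum of \<open>d(u) d(v)\<close> over the edges. The first is fixed, and the
  other two are bounded below by elementary inequalities between integers. If one of these is strict, the
  gain outweighs the error of the test vector and \<open>\<rho>(G) > x - 1\<close>. If they are equalities, then the
  degrees of \<open>H\<close> are at most \<open>1\<close> (when \<open>n \<le> 2 c\<close>), or they are in \<open>{1, 2}\<close> and no two vertices of degree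
  \<open>2\<close> are adjacent (when \<open>2 c \<le> n \<le> 3 c\<close>), or they are in \<open>{1, 2}\<close> and no two leaves are adjacent (when
  \<open>3 c \<le> n\<close>); see lemmas \<open>degree_test_matchings\<close>, \<open>degree_test_P2_P3\<close> and \<open>degree_test_P3_P4\<close>.

  These conditions force \<open>H\<close> to be a union of \<open>c\<close> paths of orders \<open>k\<close> and \<open>k + 1\<close> for a single \<open>k\<close>, so that \<open>G\<close>
  is isomorphic to \<open>P\<^bsub>n,c\<^esub>\<close> (lemma \<open>iso_P_graph\<close>), with one exception: for \<open>n = 8\<close> and \<open>c = 2\<close> they do not
  separate \<open>2 P\<^sub>4\<close> from \<open>P\<^sub>3 \<union> P\<^sub>5\<close>. There the test vector is exact, so \<open>\<rho>(G) \<le> x - 1\<close> would make it an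
  eigenvector, and the eigenvalue equation at a vertex of degree \<open>2\<close> with two neighbours of degree \<open>2\<close> fails
  (lemma \<open>P4_degree_vector_eigen\<close>).
\<close>

section \<open>Rayleigh quotients and the distance spectral radius\<close>

definition quad_form :: "'a set \<Rightarrow> ('a \<Rightarrow> 'a \<Rightarrow> real) \<Rightarrow> ('a \<Rightarrow> real) \<Rightarrow> real" where
  "quad_form V M y = (\<Sum>u\<in>V. \<Sum>v\<in>V. M u v * y u * y v)"

lemma quad_form_cong:
  assumes "\<And>u v. u \<in> V \<Longrightarrow> v \<in> V \<Longrightarrow> M u v = M' u v" "\<And>u. u \<in> V \<Longrightarrow> y u = y' u"
  shows "quad_form V M y = quad_form V M' y'"
  unfolding quad_form_def using assms by (intro sum.cong refl) auto

lemma quad_form_scale: "quad_form V M (\<lambda>v. t * y v) = t\<^sup>2 * quad_form V M y"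
  unfolding quad_form_def by (simp add: sum_distrib_left power2_eq_square mult_ac)

lemma quad_form_add:
  assumes sym: "\<And>u v. u \<in> V \<Longrightarrow> v \<in> V \<Longrightarrow> M u v = M v u"
  shows "quad_form V M (\<lambda>v. y v + t * z v) =
    quad_form V M y + 2 * t * (\<Sum>u\<in>V. z u * (\<Sum>v\<in>V. M u v * y v)) + t\<^sup>2 * quad_form V M z"
proof -
  have *: "(\<Sum>u\<in>V. \<Sum>v\<in>V. M u v * y u * z v) = (\<Sum>u\<in>V. \<Sum>v\<in>V. M u v * z u * y v)"
    by (subst sum.swap) (intro sum.cong refl, simp add: sym mult_ac)
  have "quad_form V M (\<lambda>v. y v + t * z v) = quad_form V M y
    + t * (\<Sum>u\<in>V. \<Sum>v\<in>V. M u v * y u * z v) + t * (\<Sum>u\<in>V. \<Sum>v\<in>V. M u v * z u * y v)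
    + t\<^sup>2 * quad_form V M z"
    unfolding quad_form_def
    by (simp add: sum_distrib_left algebra_simps power2_eq_square sum.distrib)
  then show ?thesis unfolding * by (simp add: sum_distrib_left mult_ac)
qed

text \<open>
  A vector attaining the bound is a critical point of the Rayleigh quotient: perturbing it in the direction
  of the unit vector at \<open>u\<close> gives a quadratic polynomial in the step size whose linear coefficient has to vanish.
\<close>

lemma quad_form_max_imp_eigen:
  fixes y :: "'a \<Rightarrow> real"
  assumes fin: "finite V" and sym: "\<And>u v. u \<in> V \<Longrightarrow> v \<in> V \<Longrightarrow> M u v = M v u"
    and le: "\<And>z. quad_form V M z \<le> k * (\<Sum>v\<in>V. (z v)\<^sup>2)"
    and ge: "k * (\<Sum>v\<in>V. (y v)\<^sup>2) \<le> quad_form V M y"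
    and u: "u \<in> V"
  shows "(\<Sum>v\<in>V. M u v * y v) = k * y u"
proof -
  define z where "z = (\<lambda>v. if v = u then 1 else 0 :: real)"
  define a where "a = (\<Sum>v\<in>V. M u v * y v) - k * y u"
  \<comment> \<open>Positive and at least the modulus of the quadratic coefficient, so that the step \<open>a / b\<close> refutes \<open>a \<noteq> 0\<close>.\<close>
  define b where "b = \<bar>quad_form V M z - k\<bar> + 1"
  have z1: "(\<Sum>w\<in>V. z w * g w) = g u" for g :: "'a \<Rightarrow> real"
    using fin u by (simp add: z_def if_distrib[where f = "\<lambda>x. x * _"] sum.delta cong: if_cong)
  have z2: "(\<Sum>v\<in>V. (y v + t * z v)\<^sup>2) = (\<Sum>v\<in>V. (y v)\<^sup>2) + 2 * t * y u + t\<^sup>2" for t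
  proof -
    have "(\<Sum>v\<in>V. (y v + t * z v)\<^sup>2) = (\<Sum>v\<in>V. (y v)\<^sup>2 + z v * (2 * t * y v + t\<^sup>2 * z v))"
      by (simp add: power2_eq_square algebra_simps)
    also have "\<dots> = (\<Sum>v\<in>V. (y v)\<^sup>2) + (2 * t * y u + t\<^sup>2 * z u)"
      by (simp only: sum.distrib z1)
    finally show ?thesis by (simp add: z_def)
  qed
  have main: "2 * t * a + t\<^sup>2 * (quad_form V M z - k) \<le> 0" for t
  proof -
    have "quad_form V M y + 2 * t * (\<Sum>v\<in>V. M u v * y v) + t\<^sup>2 * quad_form V M z
       \<le> k * ((\<Sum>v\<in>V. (y v)\<^sup>2) + 2 * t * y u + t\<^sup>2)"
      using le[of "\<lambda>v. y v + t * z v"]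
      unfolding quad_form_add[of V M, OF sym, simplified] z1 z2 by simp
    with ge show ?thesis by (simp add: a_def algebra_simps)
  qed
  have b: "b > 0" "quad_form V M z - k \<ge> -b" by (auto simp: b_def)
  have "2 * (a / b) * a + (a / b)\<^sup>2 * (-b) \<le> 2 * (a / b) * a + (a / b)\<^sup>2 * (quad_form V M z - k)"
    using b(2) by (intro add_left_mono mult_left_mono) auto
  also have "\<dots> \<le> 0" by (rule main)
  finally have "a\<^sup>2 / b \<le> 0" using b(1) by (simp add: power2_eq_square field_simps)
  then have "a = 0" using b(1) by (simp add: divide_le_0_iff)
  then show ?thesis by (simp add: a_def)
qed

text \<open>
  The quadratic form attains its maximum on the unit sphere, which is compact as a closed subset of a
  product of intervals; the maximiser is an eigenvector.
\<close>

lemma rayleigh_principle: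
  fixes M :: "'a \<Rightarrow> 'a \<Rightarrow> real"
  assumes fin: "finite V" and ne: "V \<noteq> {}"
    and sym: "\<And>u v. u \<in> V \<Longrightarrow> v \<in> V \<Longrightarrow> M u v = M v u"
  obtains k f where "\<exists>v\<in>V. f v \<noteq> 0" "\<And>u. u \<in> V \<Longrightarrow> (\<Sum>v\<in>V. M u v * f v) = k * f u"
    "\<And>y. quad_form V M y \<le> k * (\<Sum>v\<in>V. (y v)\<^sup>2)"
proof -
  \<comment> \<open>Coordinates outside \<open>V\<close> are pinned to \<open>0\<close>, so the sphere over \<open>V\<close> is compact in the space of all functions.\<close>
  define C where "C = PiE UNIV (\<lambda>v. if v \<in> V then {-1..1} else {0::real})"
  have C: "compact C" 
    unfolding C_def compactin_euclidean_iff[symmetric] euclidean_product_topology[symmetric]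
    by (subst compactin_PiE) auto
  define S where "S = C \<inter> {y. (\<Sum>v\<in>V. (y v)\<^sup>2) = 1}"
  have "closed {y::'a \<Rightarrow> real. (\<Sum>v\<in>V. (y v)\<^sup>2) = 1}"
    by (intro closed_Collect_eq continuous_intros continuous_on_product_coordinates)
  then have S: "compact S" unfolding S_def using C by (rule compact_Int_closed[rotated])
  obtain w where w: "w \<in> V" using ne by blast
  have wS: "(\<lambda>v. if v = w then 1 else 0) \<in> S"
    using fin w by (auto simp: S_def C_def if_distrib[where f = "\<lambda>x. x\<^sup>2"] cong: if_cong)
  have "continuous_on S (quad_form V M)"
    unfolding quad_form_def
    by (intro continuous_intros continuous_on_subset[OF continuous_on_product_coordinates]) auto
  then obtain f where f: "f \<in> S" "\<And>y. y \<in> S \<Longrightarrow> quad_form V M y \<le> quad_form V M f"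
    using continuous_attains_sup[OF S] wS by (metis empty_iff)
  define k where "k = quad_form V M f"
  have f1: "(\<Sum>v\<in>V. (f v)\<^sup>2) = 1" using f(1) by (simp add: S_def)
  have le: "quad_form V M y \<le> k * (\<Sum>v\<in>V. (y v)\<^sup>2)" for y
  proof (cases "(\<Sum>v\<in>V. (y v)\<^sup>2) = 0")
    case True
    then have "y v = 0" if "v \<in> V" for v using that fin by (simp add: sum_nonneg_eq_0_iff)
    then have "quad_form V M y = 0" by (simp add: quad_form_def)
    with True show ?thesis by simp
  next
    case False
    define r where "r = (\<Sum>v\<in>V. (y v)\<^sup>2)"
    have r: "r > 0" using False sum_nonneg[of V "\<lambda>v. (y v)\<^sup>2"] unfolding r_def by auto
    define z where "z = (\<lambda>v. if v \<in> V then (1 / sqrt r) * y v else 0)"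
    have z1: "(\<Sum>v\<in>V. (z v)\<^sup>2) = 1"
    proof -
      have "(\<Sum>v\<in>V. (z v)\<^sup>2) = (\<Sum>v\<in>V. (y v)\<^sup>2 / r)"
        using r by (intro sum.cong) (auto simp: z_def power_divide)
      also have "\<dots> = (\<Sum>v\<in>V. (y v)\<^sup>2) / r" by (simp add: sum_divide_distrib)
      also have "\<dots> = r / r" by (simp add: r_def)
      finally show ?thesis using r by simp
    qed
    have "\<bar>z v\<bar> \<le> 1" if "v \<in> V" for v
    proof -
      have "(z v)\<^sup>2 \<le> (\<Sum>v\<in>V. (z v)\<^sup>2)" using fin that by (intro member_le_sum) auto
      then show ?thesis unfolding z1 by (simp add: abs_square_le_1)
    qed
    then have "z v \<in> (if v \<in> V then {-1..1} else {0})" for v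
      by (cases "v \<in> V") (force simp: abs_le_iff, simp add: z_def)
    then have "z \<in> S" using z1 by (auto simp: S_def C_def PiE_def Pi_def)
    then have "quad_form V M z \<le> k" unfolding k_def by (rule f(2))
    moreover have "quad_form V M z = (1 / sqrt r)\<^sup>2 * quad_form V M y"
      unfolding quad_form_scale[symmetric] by (rule quad_form_cong) (auto simp: z_def)
    ultimately show ?thesis using r unfolding r_def[symmetric] by (simp add: power_divide field_simps)
  qed
  show thesis
  proof (rule that[of f k])
    show "\<exists>v\<in>V. f v \<noteq> 0" using f1 by (metis (mono_tags) power_zero_numeral sum.neutral zero_neq_one)
    show "(\<Sum>v\<in>V. M u v * f v) = k * f u" if "u \<in> V" for u
      by (rule quad_form_max_imp_eigen[OF fin sym le _ that]) (simp_all add: f1 k_def)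
  qed (rule le)
qed

abbreviation dist_mat :: "'a pair_pre_digraph \<Rightarrow> 'a \<Rightarrow> 'a \<Rightarrow> real" where
  "dist_mat G u v \<equiv> real (graph_dist G u v)"

lemma distance_spectrum:
  assumes "finite (pverts G)"
  shows "k \<in> spectrum (distance_matrix G) \<longleftrightarrow> (\<exists>f. (\<exists>v\<in>pverts G. f v \<noteq> 0) \<and>
      (\<forall>u\<in>pverts G. (\<Sum>v\<in>pverts G. dist_mat G u v * f v) = k * f u))"
proof -
  define vs where "vs = (SOME vs. distinct vs \<and> set vs = pverts G)"
  have "distinct vs \<and> set vs = pverts G"
    unfolding vs_def by (rule someI_ex) (use finite_distinct_list[OF assms] in blast)
  then show ?thesis
    using eigenvalue_distance_matrix_wrt[of vs G k]
    by (simp add: spectrum_def distance_matrix_def vs_def[symmetric])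
qed

lemma finite_distance_spectrum: "finite (spectrum (distance_matrix G))"
  unfolding distance_matrix_def distance_matrix_wrt_def
  by (rule card_finite_spectrum(1)) (rule mat_carrier)

lemma distance_spectral_radius_rayleigh:
  assumes fin: "finite (pverts G)" and ne: "pverts G \<noteq> {}"
    and sym: "\<And>u v. u \<in> pverts G \<Longrightarrow> v \<in> pverts G \<Longrightarrow> graph_dist G u v = graph_dist G v u"
  shows "quad_form (pverts G) (dist_mat G) y \<le> distance_spectral_radius G * (\<Sum>v\<in>pverts G. (y v)\<^sup>2)"
proof -
  obtain k f where k: "\<exists>v\<in>pverts G. f v \<noteq> 0"
    "\<And>u. u \<in> pverts G \<Longrightarrow> (\<Sum>v\<in>pverts G. dist_mat G u v * f v) = k * f u"
    "\<And>y. quad_form (pverts G) (dist_mat G) y \<le> k * (\<Sum>v\<in>pverts G. (y v)\<^sup>2)"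
    by (rule rayleigh_principle[OF fin ne, of "dist_mat G"]) (use sym in auto)
  have "k \<in> spectrum (distance_matrix G)"
    using k(1,2) by (auto simp: distance_spectrum[OF fin])
  then have "k \<le> distance_spectral_radius G"
    unfolding distance_spectral_radius_def by (rule Max_ge[OF finite_distance_spectrum])
  then have "k * (\<Sum>v\<in>pverts G. (y v)\<^sup>2) \<le> distance_spectral_radius G * (\<Sum>v\<in>pverts G. (y v)\<^sup>2)"
    by (intro mult_right_mono sum_nonneg) auto
  with k(3)[of y] show ?thesis by linarith
qed

text \<open>
  For a nonnegative symmetric matrix a positive eigenvector belongs to the largest eigenvalue: pairing it with
  the absolute values of the entries of any other eigenvector bounds the other eigenvalue.
\<close>

lemma distance_spectral_radius_eqI:
  assumes fin: "finite (pverts G)" and ne: "pverts G \<noteq> {}"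
    and sym: "\<And>u v. u \<in> pverts G \<Longrightarrow> v \<in> pverts G \<Longrightarrow> graph_dist G u v = graph_dist G v u"
    and pos: "\<And>v. v \<in> pverts G \<Longrightarrow> y v > 0"
    and eig: "\<And>u. u \<in> pverts G \<Longrightarrow> (\<Sum>v\<in>pverts G. dist_mat G u v * y v) = k * y u"
  shows "distance_spectral_radius G = k"
proof -
  let ?V = "pverts G"
  have "l \<le> k" if "l \<in> spectrum (distance_matrix G)" for l
  proof -
    obtain f w where w: "w \<in> ?V" "f w \<noteq> 0"
      and f: "\<And>u. u \<in> ?V \<Longrightarrow> (\<Sum>v\<in>?V. dist_mat G u v * f v) = l * f u"
      using \<open>l \<in> _\<close> unfolding distance_spectrum[OF fin] by blast
    have "(\<Sum>u\<in>?V. y u * (\<Sum>v\<in>?V. dist_mat G u v * \<bar>f v\<bar>)) =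
        (\<Sum>v\<in>?V. \<bar>f v\<bar> * (\<Sum>u\<in>?V. dist_mat G v u * y u))"
      unfolding sum_distrib_left by (subst sum.swap) (intro sum.cong refl, simp add: sym mult_ac)
    also have "\<dots> = (\<Sum>v\<in>?V. k * (y v * \<bar>f v\<bar>))"
      by (intro sum.cong refl) (simp only: eig, simp)
    also have "\<dots> = k * (\<Sum>v\<in>?V. y v * \<bar>f v\<bar>)"
      by (simp only: sum_distrib_left)
    finally have 1: "(\<Sum>u\<in>?V. y u * (\<Sum>v\<in>?V. dist_mat G u v * \<bar>f v\<bar>)) = k * (\<Sum>v\<in>?V. y v * \<bar>f v\<bar>)" .
    have "l * (\<Sum>v\<in>?V. y v * \<bar>f v\<bar>) \<le> (\<Sum>u\<in>?V. y u * (\<Sum>v\<in>?V. dist_mat G u v * \<bar>f v\<bar>))"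
      unfolding sum_distrib_left[of l]
    proof (rule sum_mono)
      fix u assume u: "u \<in> ?V"
      have "l * \<bar>f u\<bar> \<le> \<bar>l * f u\<bar>" by (simp add: abs_mult mult_right_mono)
      also have "\<dots> \<le> (\<Sum>v\<in>?V. \<bar>dist_mat G u v * f v\<bar>)"
        unfolding f[OF u, symmetric] by (rule sum_abs)
      finally have "l * \<bar>f u\<bar> \<le> (\<Sum>v\<in>?V. dist_mat G u v * \<bar>f v\<bar>)" by (simp add: abs_mult)
      then have "y u * (l * \<bar>f u\<bar>) \<le> y u * (\<Sum>v\<in>?V. dist_mat G u v * \<bar>f v\<bar>)"
        using pos[OF u] by (intro mult_left_mono) auto
      then show "l * (y u * \<bar>f u\<bar>) \<le> y u * (\<Sum>v\<in>?V. dist_mat G u v * \<bar>f v\<bar>)"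
        by (simp add: mult_ac)
    qed
    moreover have "0 < (\<Sum>v\<in>?V. y v * \<bar>f v\<bar>)"
      using fin w pos by (intro sum_pos2[of _ w]) (auto simp: less_imp_le)
    ultimately show "l \<le> k" unfolding 1 by (simp add: mult_le_cancel_right)
  qed
  moreover have "k \<in> spectrum (distance_matrix G)"
  proof -
    have "\<exists>v\<in>?V. y v \<noteq> 0" using ne pos by force
    then show ?thesis using eig by (auto simp: distance_spectrum[OF fin])
  qed
  ultimately show ?thesis unfolding distance_spectral_radius_def
    by (intro Max_eqI finite_distance_spectrum)
qed

section \<open>Distances in simple graphs\<close>

lemma (in pair_graph) graph_dist_commute: "graph_dist G u v = graph_dist G v u"
proof -
  have "(\<exists>p. apath u p v \<and> length p = k) \<longleftrightarrow> (\<exists>p. apath v p u \<and> length p = k)" for k u v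
  proof -
    have len: "length (rev_path p) = length p" for p :: "('a \<times> 'a) list"
      by (induction p) auto
    show ?thesis by (metis apath_rev_path len)
  qed
  then show ?thesis unfolding graph_dist_def by simp
qed

lemma graph_dist_le:
  assumes "pre_digraph.apath (with_proj G) u p v"
  shows "graph_dist G u v \<le> length p"
  unfolding graph_dist_def by (rule Least_le) (use assms in blast)

text \<open>
  The minimum in the definition of the distance is attained as soon as some path exists.
\<close>

lemma graph_dist_attained:
  assumes "pre_digraph.apath (with_proj G) u p v"
  obtains q where "pre_digraph.apath (with_proj G) u q v" "length q = graph_dist G u v"
  using LeastI[of "\<lambda>k. \<exists>p. pre_digraph.apath (with_proj G) u p v \<and> length p = k" "length p"] assms
  unfolding graph_dist_def by blast

lemma (in pair_graph) graph_dist_ge_1: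
  assumes "apath u p v" "u \<noteq> v"
  shows "1 \<le> graph_dist G u v"
proof -
  obtain q where q: "apath u q v" "length q = graph_dist G u v"
    by (rule graph_dist_attained[OF assms(1)])
  then have "q \<noteq> []" using assms(2) by (auto simp: apath_Nil_iff)
  then show ?thesis unfolding q(2)[symmetric] by (cases q) auto
qed

lemma (in pair_graph) graph_dist_ge_2:
  assumes "apath u p v" "u \<noteq> v" "(u, v) \<notin> parcs G"
  shows "2 \<le> graph_dist G u v"
proof -
  obtain q where q: "apath u q v" "length q = graph_dist G u v"
    by (rule graph_dist_attained[OF assms(1)])
  have "q \<noteq> []" using q(1) assms(2) by (auto simp: apath_Nil_iff)
  moreover have "q \<noteq> [e]" for e
    using q(1) assms(3) by (auto simp: apath_def awalk_def)
  ultimately show ?thesis unfolding q(2)[symmetric]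
    by (cases q; cases "tl q") auto
qed

lemma (in pair_graph) graph_dist_self: "u \<in> pverts G \<Longrightarrow> graph_dist G u u = 0"
  using graph_dist_le[of G u "[]" u] by (simp add: apath_Nil_iff)

lemma (in pair_graph) graph_dist_eq_1:
  assumes "(u, v) \<in> parcs G"
  shows "graph_dist G u v = 1"
proof -
  have "apath u [(u, v)] v" "u \<noteq> v"
    using assms pair_no_loops[OF assms] by (auto simp: apath_Cons_iff apath_Nil_iff dest: in_arcsD1 in_arcsD2)
  then show ?thesis using graph_dist_ge_1[of u _ v] graph_dist_le[of G u "[(u, v)]" v] by fastforce
qed

text \<open>
  This is how all distances in a graph of diameter at most \<open>2\<close> are read off from its adjacencies.
\<close>

lemma (in pair_graph) graph_dist_eq_2:
  assumes "(u, w) \<in> parcs G" "(w, v) \<in> parcs G" "u \<noteq> v" "(u, v) \<notin> parcs G"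
  shows "graph_dist G u v = 2"
proof -
  have "apath u [(u, w), (w, v)] v"
    using assms pair_no_loops[OF assms(1)] pair_no_loops[OF assms(2)]
    by (auto simp: apath_Cons_iff apath_Nil_iff dest: in_arcsD1 in_arcsD2)
  then show ?thesis
    using graph_dist_ge_2[of u _ v] graph_dist_le[of G u "[(u, w), (w, v)]" v] assms by fastforce
qed

lemma (in pair_graph) connected_imp_apath:
  assumes "Digraph_Component.connected (with_proj G)" "u \<in> pverts G" "v \<in> pverts G"
  obtains p where "apath u p v"
proof -
  have "strongly_connected (with_proj G)"
    using symmetric_connected_imp_strongly_connected pair_sym_arcs assms(1) by blast
  then have "u \<rightarrow>\<^sup>*\<^bsub>with_proj G\<^esub> v" using assms(2,3) by (auto elim!: strongly_connectedE)
  then show thesis using that reachable_apath by blast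
qed

lemma (in pair_graph) card_parcs: "card (parcs G) = 2 * card (edges G)"
proof -
  have fin: "finite (edges G)" unfolding edges_def using pair_finite_arcs by simp
  have "parcs G = (\<Union>e\<in>edges G. {a \<in> parcs G. (\<lambda>(u, v). {u, v}) a = e})"
    by (auto simp: edges_def)
  then have "card (parcs G) = card (\<Union>e\<in>edges G. {a \<in> parcs G. (\<lambda>(u, v). {u, v}) a = e})"
    by simp
  also have "\<dots> = (\<Sum>e\<in>edges G. card {a \<in> parcs G. (\<lambda>(u, v). {u, v}) a = e})"
    using fin pair_finite_arcs by (intro card_UN_disjoint) auto
  also have "\<dots> = (\<Sum>e\<in>edges G. 2)"
  proof (rule sum.cong[OF refl])
    fix e assume "e \<in> edges G"
    then obtain u v where e: "e = {u, v}" "(u, v) \<in> parcs G" by (auto simp: edges_def)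
    have "(v, u) \<in> parcs G" using pair_sym_arcs e(2) by (auto simp: symmetric_def sym_def)
    moreover have "u \<noteq> v" using pair_no_loops[OF e(2)] by simp
    ultimately have "{a \<in> parcs G. (\<lambda>(u, v). {u, v}) a = e} = {(u, v), (v, u)}" "(u, v) \<noteq> (v, u)"
      using e by (auto simp: doubleton_eq_iff)
    then show "card {a \<in> parcs G. (\<lambda>(u, v). {u, v}) a = e} = 2" by simp
  qed
  finally show ?thesis by simp
qed

section \<open>Degree vectors as test vectors\<close>

text \<open>
  If \<open>N\<close> gives the neighbourhoods of the complement graph, this is the minimum of the distance and \<open>2\<close>.
\<close>

abbreviation truncated_dist :: "('a \<Rightarrow> 'a set) \<Rightarrow> 'a \<Rightarrow> 'a \<Rightarrow> real" where
  "truncated_dist N u v \<equiv> if u = v then 0 else if v \<in> N u then 2 else 1"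

text \<open>
  Simple graphs given by neighbourhoods. The locale is used for the complement of the graph whose distances are
  studied, which need not be connected.
\<close>

locale nbr_graph =
  fixes V :: "'a set" and N :: "'a \<Rightarrow> 'a set"
  assumes fin: "finite V"
    and nbr_subset: "v \<in> V \<Longrightarrow> N v \<subseteq> V"
    and nbr_sym: "u \<in> V \<Longrightarrow> v \<in> N u \<Longrightarrow> u \<in> N v"
    and nbr_irrefl: "v \<notin> N v"
begin

abbreviation deg :: "'a \<Rightarrow> nat" where "deg v \<equiv> card (N v)"

lemma finite_nbr: "v \<in> V \<Longrightarrow> finite (N v)"
  using nbr_subset fin finite_subset by blast

lemma deg_pos: "v \<in> V \<Longrightarrow> u \<in> N v \<Longrightarrow> deg v \<ge> 1"
  using finite_nbr by (metis One_nat_def Suc_leI card_gt_0_iff empty_iff)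

lemma deg_pos': "v \<in> V \<Longrightarrow> u \<in> N v \<Longrightarrow> deg u \<ge> 1"
  using deg_pos nbr_sym nbr_subset by blast

lemma arc_sum_swap:
  fixes g :: "'a \<Rightarrow> 'a \<Rightarrow> 'b :: comm_monoid_add"
  shows "(\<Sum>v\<in>V. \<Sum>u\<in>N v. g v u) = (\<Sum>v\<in>V. \<Sum>u\<in>N v. g u v)"
proof -
  have "(\<Sum>v\<in>V. \<Sum>u\<in>N v. g v u) = (\<Sum>v\<in>V. \<Sum>u\<in>{u\<in>V. u \<in> N v}. g v u)"
    using nbr_subset by (intro sum.cong) auto
  also have "\<dots> = (\<Sum>u\<in>V. \<Sum>v\<in>{v\<in>V. u \<in> N v}. g v u)"
    by (rule sum.swap_restrict[OF fin fin])
  also have "\<dots> = (\<Sum>u\<in>V. \<Sum>v\<in>N u. g v u)"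
    using nbr_subset nbr_sym by (intro sum.cong) auto
  finally show ?thesis .
qed

lemma arc_sum_tail:
  fixes g :: "'a \<Rightarrow> 'b :: comm_semiring_1"
  shows "(\<Sum>v\<in>V. \<Sum>u\<in>N v. g v) = (\<Sum>v\<in>V. of_nat (deg v) * g v)"
  by simp

lemma arc_sum_head:
  fixes g :: "'a \<Rightarrow> 'b :: comm_semiring_1"
  shows "(\<Sum>v\<in>V. \<Sum>u\<in>N v. g u) = (\<Sum>v\<in>V. of_nat (deg v) * g v)"
  by (subst arc_sum_swap) simp

text \<open>
  The numbers of walks with one, two and three edges. They are the coefficients of the quadratic form of the
  adjacency matrix at a vector that is affine in the degrees, and they are kept as integers because the final estimates
  use that a positive integer is at least \<open>1\<close>.
\<close>

definition walks1 :: int where "walks1 = (\<Sum>v\<in>V. int (deg v))"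
definition walks2 :: int where "walks2 = (\<Sum>v\<in>V. int (deg v) * int (deg v))"
definition walks3 :: int where "walks3 = (\<Sum>v\<in>V. \<Sum>u\<in>N v. int (deg v) * int (deg u))"

text \<open>
  This is \<open>y\<^sup>T (J + A) y - x y\<^sup>T y\<close> for the adjacency matrix \<open>A\<close> and the all-ones matrix \<open>J\<close>. A positive value means that
  \<open>J + A\<close> has an eigenvalue above \<open>x\<close>.
\<close>

definition rayleigh_gap :: "real \<Rightarrow> ('a \<Rightarrow> real) \<Rightarrow> real" where
  "rayleigh_gap x y = (\<Sum>v\<in>V. y v)\<^sup>2 + (\<Sum>v\<in>V. \<Sum>u\<in>N v. y v * y u) - x * (\<Sum>v\<in>V. (y v)\<^sup>2)"

lemma arc_sum_shifted:
  "(\<Sum>v\<in>V. \<Sum>u\<in>N v. (int (deg v) - a) * (int (deg u) - a)) = walks3 - 2 * a * walks2 + a\<^sup>2 * walks1"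
proof -
  have "(\<Sum>v\<in>V. \<Sum>u\<in>N v. (int (deg v) - a) * (int (deg u) - a)) =
     (\<Sum>v\<in>V. \<Sum>u\<in>N v. int (deg v) * int (deg u)) - a * (\<Sum>v\<in>V. \<Sum>u\<in>N v. int (deg v))
     - a * (\<Sum>v\<in>V. \<Sum>u\<in>N v. int (deg u)) + a\<^sup>2 * (\<Sum>v\<in>V. \<Sum>u\<in>N v. 1)"
    by (simp only: sum_distrib_left sum.distrib[symmetric] sum_subtractf[symmetric])
      (intro sum.cong refl, simp add: algebra_simps power2_eq_square)
  also have "\<dots> = walks3 - 2 * a * walks2 + a\<^sup>2 * walks1"
    unfolding arc_sum_tail arc_sum_head walks1_def walks2_def walks3_def by simp
  finally show ?thesis .
qed

text \<open>
  The square of the entry sum \<open>S\<close> is replaced by its tangent \<open>2 D S - D\<^sup>2\<close>, which loses nothing if \<open>S = D\<close>. In the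
  applications \<open>D\<close> clears the denominators in the secular equation, which makes the bound linear in the walk numbers.
\<close>

lemma rayleigh_gap_degree_vector:
  fixes \<alpha> \<beta> D x :: real
  shows "rayleigh_gap x (\<lambda>v. \<alpha> + \<beta> * real (deg v)) \<ge>
     2 * D * (card V * \<alpha> + \<beta> * walks1) - D\<^sup>2 + \<alpha>\<^sup>2 * walks1 + 2 * \<alpha> * \<beta> * walks2 + \<beta>\<^sup>2 * walks3
     - x * (card V * \<alpha>\<^sup>2 + 2 * \<alpha> * \<beta> * walks1 + \<beta>\<^sup>2 * walks2)"
proof -
  define S where "S = (\<Sum>v\<in>V. \<alpha> + \<beta> * real (deg v))"
  have w1: "real_of_int walks1 = (\<Sum>v\<in>V. real (deg v))"
    and w2: "real_of_int walks2 = (\<Sum>v\<in>V. real (deg v) * real (deg v))"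
    and w3: "real_of_int walks3 = (\<Sum>v\<in>V. \<Sum>u\<in>N v. real (deg v) * real (deg u))"
    by (simp_all add: walks1_def walks2_def walks3_def)
  have S: "S = card V * \<alpha> + \<beta> * walks1"
    unfolding S_def w1 by (simp add: sum.distrib sum_distrib_left)
  have sq: "(\<Sum>v\<in>V. (\<alpha> + \<beta> * real (deg v))\<^sup>2) = card V * \<alpha>\<^sup>2 + 2 * \<alpha> * \<beta> * walks1 + \<beta>\<^sup>2 * walks2"
    unfolding w1 w2
    by (simp add: sum.distrib sum_distrib_left power2_eq_square algebra_simps)
  have "(\<Sum>v\<in>V. \<Sum>u\<in>N v. (\<alpha> + \<beta> * real (deg v)) * (\<alpha> + \<beta> * real (deg u))) =
     \<alpha>\<^sup>2 * (\<Sum>v\<in>V. \<Sum>u\<in>N v. 1) + \<alpha> * \<beta> * (\<Sum>v\<in>V. \<Sum>u\<in>N v. real (deg v))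
     + \<alpha> * \<beta> * (\<Sum>v\<in>V. \<Sum>u\<in>N v. real (deg u)) + \<beta>\<^sup>2 * walks3"
    unfolding w3 by (simp only: sum_distrib_left sum.distrib[symmetric])
      (intro sum.cong refl, simp add: algebra_simps power2_eq_square)
  also have "\<dots> = \<alpha>\<^sup>2 * walks1 + 2 * \<alpha> * \<beta> * walks2 + \<beta>\<^sup>2 * walks3"
    unfolding arc_sum_tail arc_sum_head w1 w2 by simp
  finally have arcs: "(\<Sum>v\<in>V. \<Sum>u\<in>N v. (\<alpha> + \<beta> * real (deg v)) * (\<alpha> + \<beta> * real (deg u))) =
    \<alpha>\<^sup>2 * walks1 + 2 * \<alpha> * \<beta> * walks2 + \<beta>\<^sup>2 * walks3" .
  have "0 \<le> (S - D)\<^sup>2" by simp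
  then have "2 * D * S - D\<^sup>2 \<le> S\<^sup>2" by (simp add: power2_eq_square algebra_simps)
  then show ?thesis unfolding rayleigh_gap_def sq arcs S_def[symmetric] unfolding S by linarith
qed

text \<open>
  The shift by \<open>1\<close> comes from the diagonal: the matrix on the left is \<open>J - I + A\<close>.
\<close>

lemma quad_form_distance_lower:
  "quad_form V (truncated_dist N) y =
    rayleigh_gap x y + (x - 1) * (\<Sum>v\<in>V. (y v)\<^sup>2)"
proof -
  have "quad_form V (truncated_dist N) y =
     (\<Sum>u\<in>V. \<Sum>v\<in>V. y u * y v + (if v \<in> N u then y u * y v else 0) - (if v = u then y u * y u else 0))"
    unfolding quad_form_def by (intro sum.cong refl) (auto simp: nbr_irrefl)
  also have "\<dots> = (\<Sum>u\<in>V. \<Sum>v\<in>V. y u * y v) + (\<Sum>u\<in>V. \<Sum>v\<in>V. if v \<in> N u then y u * y v else 0)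
     - (\<Sum>u\<in>V. \<Sum>v\<in>V. if v = u then y u * y u else 0)"
    by (simp add: sum.distrib sum_subtractf)
  also have "(\<Sum>u\<in>V. \<Sum>v\<in>V. y u * y v) = (\<Sum>u\<in>V. y u)\<^sup>2"
    by (simp add: power2_eq_square sum_product)
  also have "(\<Sum>u\<in>V. \<Sum>v\<in>V. if v \<in> N u then y u * y v else 0) = (\<Sum>u\<in>V. \<Sum>v\<in>N u. y u * y v)"
  proof (rule sum.cong[OF refl])
    fix u assume "u \<in> V"
    then have "N u = {v\<in>V. v \<in> N u}" using nbr_subset by blast
    then show "(\<Sum>v\<in>V. if v \<in> N u then y u * y v else 0) = (\<Sum>v\<in>N u. y u * y v)"
      using fin by (simp add: sum.inter_filter[symmetric])
  qed
  also have "(\<Sum>u\<in>V. \<Sum>v\<in>V. if v = u then y u * y u else 0) = (\<Sum>u\<in>V. (y u)\<^sup>2)"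
    using fin by (simp add: power2_eq_square)
  finally show ?thesis by (simp add: rayleigh_gap_def algebra_simps)
qed

text \<open>
  The vector \<open>x - 1 + d\<close> is \<open>x (x - 1)\<close> times the solution of \<open>(x - A) y = 1\<close> on copies of \<open>P\<^sub>1\<close> and \<open>P\<^sub>2\<close>,
  so it is exact for matchings. Any other graph with the same number of edges has an excess \<open>U > 0\<close> of \<open>\<Sum> d\<^sup>2\<close>
  over \<open>\<Sum> d\<close>.
\<close>

lemma degree_test_matchings:
  fixes x c :: real
  assumes x: "x \<ge> 3" and w1: "walks1 = 2 * (card V - c)"
    and secular: "(2 * c - card V) * (1 / x) + (card V - c) * (2 / (x - 1)) = 1"
  shows "rayleigh_gap x (\<lambda>v. x - 1 + real (deg v)) > 0 \<or> (\<forall>v\<in>V. deg v \<le> 1)"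
proof -
  define n where "n = real (card V)"
  define U where "U = walks2 - walks1"
  define T where "T = walks3 - walks1"
  have sec: "x * (x - 1) = (2 * c - n) * (x - 1) + 2 * (n - c) * x"
    using secular x unfolding n_def[symmetric] by (simp add: field_simps)
  have U: "U = (\<Sum>v\<in>V. int (deg v) * (int (deg v) - 1))"
    by (simp add: U_def walks1_def walks2_def sum_subtractf algebra_simps)
  have nonneg: "0 \<le> int k * (int k - 1)" for k by (cases k) auto
  have U0: "U \<ge> 0" unfolding U by (intro sum_nonneg nonneg)
  have "walks1 = (\<Sum>v\<in>V. \<Sum>u\<in>N v. 1)" by (simp add: walks1_def)
  also have "\<dots> \<le> walks3" unfolding walks3_def
  proof (intro sum_mono)
    fix v u assume "v \<in> V" "u \<in> N v"
    then have "1 \<le> deg v * deg u" using deg_pos[of v u] deg_pos'[of v u] by simp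
    then show "1 \<le> int (deg v) * int (deg u)" by (metis of_nat_1 of_nat_le_iff of_nat_mult)
  qed
  finally have T0: "T \<ge> 0" by (simp add: T_def)
  have "(x - 2) * U + T =
     2 * (x * (x - 1)) * (n * (x - 1) + walks1) - (x * (x - 1)) * (x * (x - 1)) + (x - 1)\<^sup>2 * walks1
     + 2 * (x - 1) * walks2 + walks3
     - x * (n * (x - 1)\<^sup>2 + 2 * (x - 1) * walks1 + walks2)"
    unfolding U_def T_def of_int_diff w1
    by (subst (3) sec) (simp add: n_def[symmetric] power2_eq_square algebra_simps)
  also have "\<dots> \<le> rayleigh_gap x (\<lambda>v. x - 1 + real (deg v))"
    using rayleigh_gap_degree_vector[of "x * (x - 1)" "x - 1" 1 x] unfolding n_def by (simp add: power2_eq_square mult_ac)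
  finally have gap: "(x - 2) * U + T \<le> rayleigh_gap x (\<lambda>v. x - 1 + real (deg v))" .
  show ?thesis
  proof (cases "U = 0")
    case True
    have "deg v \<le> 1" if "v \<in> V" for v
    proof -
      have "int (deg v) * (int (deg v) - 1) = 0"
        using True that fin nonneg unfolding U by (simp add: sum_nonneg_eq_0_iff del: mult_eq_0_iff)
      then show ?thesis by auto
    qed
    then show ?thesis by blast
  next
    case False
    then have "(x - 2) * U > 0" using U0 x by simp
    then show ?thesis using gap T0 by linarith
  qed
qed

text \<open>
  The excess measures how far the degrees are from taking only the values \<open>1\<close> and \<open>2\<close>; the product
  \<open>(d - 1) (d - 2)\<close> is nonnegative at every integer \<open>d\<close>.
\<close>

lemma degree_excess:
  fixes U :: int
  defines "U \<equiv> walks2 - 3 * walks1 + 2 * int (card V)"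
  shows "U = (\<Sum>v\<in>V. (int (deg v) - 1) * (int (deg v) - 2))"
    and "U \<ge> 0" and "U = 0 \<Longrightarrow> v \<in> V \<Longrightarrow> deg v \<in> {1, 2}"
proof -
  show U: "U = (\<Sum>v\<in>V. (int (deg v) - 1) * (int (deg v) - 2))"
    by (simp add: U_def walks1_def walks2_def sum_subtractf sum.distrib sum_distrib_left algebra_simps)
  have nonneg: "0 \<le> (int k - 1) * (int k - 2)" for k
    by (cases "k \<le> 1") (auto intro: mult_nonpos_nonpos)
  show "U \<ge> 0" unfolding U by (intro sum_nonneg nonneg)
  show "deg v \<in> {1, 2}" if "U = 0" "v \<in> V"
  proof -
    have "(int (deg v) - 1) * (int (deg v) - 2) = 0"
      using that fin nonneg unfolding U by (simp add: sum_nonneg_eq_0_iff del: mult_eq_0_iff)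
    then show ?thesis by auto
  qed
qed

text \<open>
  After division by \<open>(x - 1) (x\<^sup>2 - 2)\<close> the test vector solves \<open>(x - A) y = 1\<close> on \<open>P\<^sub>2\<close> and at the centre of \<open>P\<^sub>3\<close>;
  before division it is too small by \<open>1\<close> at both ends of a \<open>P\<^sub>3\<close>. This costs \<open>2 x\<close> for each of the \<open>q = n - 2 c\<close> copies of
  \<open>P\<^sub>3\<close>. A graph that violates the stated degree conditions has a positive degree excess \<open>U\<close> or a positive weight
  \<open>T\<close> of adjacent vertices of degree at least \<open>2\<close>, and either one gains more than \<open>2 q x\<close> because \<open>x \<ge> n \<ge> 3 q\<close>.
\<close>

lemma degree_test_P2_P3:
  fixes x c :: real
  assumes x: "x \<ge> 3" "x \<ge> card V" and w1: "walks1 = 2 * (card V - c)"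
    and c: "2 * c \<le> card V" "card V \<le> 3 * c"
    and secular: "(3 * c - card V) * (2 / (x - 1)) + (card V - 2 * c) * ((3 * x + 4) / (x\<^sup>2 - 2)) = 1"
  shows "rayleigh_gap x (\<lambda>v. (x\<^sup>2 - x - 2) + x * real (deg v)) > 0 \<or>
    (\<forall>v\<in>V. deg v \<in> {1, 2} \<and> (\<forall>u\<in>N v. \<not> (deg v = 2 \<and> deg u = 2)))"
proof -
  define n where "n = real (card V)"
  define q where "q = n - 2 * c"
  define U where "U = walks2 - 3 * walks1 + 2 * int (card V)"
  define T where "T = walks3 - 2 * walks2 + walks1"
  have x2: "x\<^sup>2 - 2 > 0" using power_mono[of 3 x 2] x by simp
  have sec: "(x - 1) * (x\<^sup>2 - 2) = (3 * c - n) * 2 * (x\<^sup>2 - 2) + (n - 2 * c) * (3 * x + 4) * (x - 1)"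
    using secular x x2 unfolding n_def[symmetric] by (simp add: divide_simps mult_ac)
  have T: "T = (\<Sum>v\<in>V. \<Sum>u\<in>N v. (int (deg v) - 1) * (int (deg u) - 1))"
    unfolding arc_sum_shifted by (simp add: T_def)
  have nonneg: "0 \<le> (int (deg v) - 1) * (int (deg u) - 1)" if "v \<in> V" "u \<in> N v" for u v
    using deg_pos[OF that] deg_pos'[OF that] by simp
  have T0: "T \<ge> 0" unfolding T by (intro sum_nonneg nonneg)
  note U0 = degree_excess(2)[folded U_def]
  define D where "D = (x - 1) * (x\<^sup>2 - 2)"
  have W2: "real_of_int walks2 = real_of_int U + 3 * real_of_int walks1 - 2 * n"
    and W3: "real_of_int walks3 = real_of_int T + 2 * real_of_int walks2 - real_of_int walks1"
    by (simp_all add: U_def T_def n_def)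
  have "x\<^sup>2 * T + x * (x\<^sup>2 - 4) * U - 2 * x * q =
     2 * D * (n * (x\<^sup>2 - x - 2) + x * walks1) - D * D + (x\<^sup>2 - x - 2)\<^sup>2 * walks1
     + 2 * (x\<^sup>2 - x - 2) * x * walks2 + x\<^sup>2 * walks3
     - x * (n * (x\<^sup>2 - x - 2)\<^sup>2 + 2 * (x\<^sup>2 - x - 2) * x * walks1 + x\<^sup>2 * walks2)"
    unfolding W3 W2 w1 q_def n_def[symmetric]
    by (subst (3) D_def, subst sec) (simp add: D_def n_def[symmetric] power2_eq_square algebra_simps)
  also have "\<dots> \<le> rayleigh_gap x (\<lambda>v. (x\<^sup>2 - x - 2) + x * real (deg v))"
    using rayleigh_gap_degree_vector[of D "x\<^sup>2 - x - 2" x x] unfolding n_def by (simp add: power2_eq_square mult_ac)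
  finally have gap: "x\<^sup>2 * T + x * (x\<^sup>2 - 4) * U - 2 * x * q
    \<le> rayleigh_gap x (\<lambda>v. (x\<^sup>2 - x - 2) + x * real (deg v))" .
  have "3 * q \<le> n" "n \<le> x" using x c unfolding q_def n_def by simp_all
  then have q: "2 * q < x" using x by linarith
  have "3 * x \<le> x\<^sup>2" using x by (simp add: power2_eq_square)
  then have q': "2 * q < x\<^sup>2 - 4" using q x by linarith
  show ?thesis
  proof (cases "U = 0 \<and> T = 0")
    case True
    have "\<not> (deg v = 2 \<and> deg u = 2)" if "v \<in> V" "u \<in> N v" for u v
    proof -
      have "(\<Sum>u\<in>N v. (int (deg v) - 1) * (int (deg u) - 1)) = 0"
        using True that fin nonneg unfolding T by (subst (asm) sum_nonneg_eq_0_iff) (auto intro!: sum_nonneg)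
      then have "(int (deg v) - 1) * (int (deg u) - 1) = 0"
        using that finite_nbr nonneg by (subst (asm) sum_nonneg_eq_0_iff) auto
      then show ?thesis by auto
    qed
    then show ?thesis using degree_excess(3)[folded U_def] True by blast
  next
    case False
    have nn: "0 \<le> x\<^sup>2 * T" "0 \<le> x * (x\<^sup>2 - 4) * U"
      using T0 U0 x \<open>3 * x \<le> x\<^sup>2\<close> by simp_all
    have "x\<^sup>2 * T + x * (x\<^sup>2 - 4) * U > 2 * x * q"
    proof (cases "T = 0")
      case True
      then have "x * (x\<^sup>2 - 4) * 1 \<le> x * (x\<^sup>2 - 4) * U"
        using False U0 x \<open>3 * x \<le> x\<^sup>2\<close> by (intro mult_left_mono) auto
      moreover have "2 * x * q < x * (x\<^sup>2 - 4)" using q' x mult_strict_left_mono[OF q', of x] by (simp add: mult_ac)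
      ultimately show ?thesis using nn by linarith
    next
      case False
      then have "x\<^sup>2 * 1 \<le> x\<^sup>2 * T" using T0 by (intro mult_left_mono) auto
      moreover have "2 * x * q < x\<^sup>2" using mult_strict_left_mono[OF q, of x] x by (simp add: mult_ac power2_eq_square)
      ultimately show ?thesis using nn by linarith
    qed
    then show ?thesis using gap by linarith
  qed
qed

text \<open>
  After division by \<open>E = x\<^sup>2 - x - 1\<close> the test vector solves \<open>(x - A) y = 1\<close> on \<open>P\<^sub>4\<close>; on each of the \<open>a = 4 c - n\<close>
  copies of \<open>P\<^sub>3\<close> it is off by an error that costs \<open>x / (x\<^sup>2 - 2)\<close>. This is less than \<open>1\<close> in total,
  whereas \<open>T\<close> and \<open>U\<close> are integers, so a violation of the degree conditions gains at least \<open>1\<close>.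
  The sum of \<open>(d(u) - 2) (d(v) - 2)\<close> over the arcs can be negative, when a leaf is adjacent to a vertex of degree
  at least \<open>3\<close>. Such a vertex has a degree excess, and adding three times the total excess makes the weight
  \<open>T\<close> nonnegative.
\<close>

lemma degree_test_P3_P4:
  fixes x c :: real
  assumes x: "x \<ge> 3" "x \<ge> card V" and w1: "walks1 = 2 * (card V - c)"
    and c: "3 * c \<le> card V" "card V \<le> 4 * c"
    and secular: "(4 * c - card V) * ((3 * x + 4) / (x\<^sup>2 - 2)) + (card V - 3 * c) * ((4 * x + 2) / (x\<^sup>2 - x - 1)) = 1"
  shows "rayleigh_gap x (\<lambda>v. x - 1 + real (deg v)) > 0 \<or>
    (\<forall>v\<in>V. deg v \<in> {1, 2} \<and> (\<forall>u\<in>N v. \<not> (deg v = 1 \<and> deg u = 1))) \<and>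
    (card V = 4 * c \<longrightarrow> rayleigh_gap x (\<lambda>v. x - 1 + real (deg v)) \<ge> 0)"
proof -
  define n where "n = real (card V)"
  define a where "a = 4 * c - n"
  define U where "U = walks2 - 3 * walks1 + 2 * int (card V)"
  define T where "T = walks3 - 4 * walks2 + 4 * walks1 + 3 * U"
  have xx: "3 * x \<le> x\<^sup>2" using x by (simp add: power2_eq_square)
  have x2: "x\<^sup>2 - 2 > 0" "x\<^sup>2 - x - 1 > 0" using xx x by linarith+
  define E where "E = x\<^sup>2 - x - 1"
  have sec: "E * (x\<^sup>2 - 2) = a * (3 * x + 4) * E + (n - 3 * c) * (4 * x + 2) * (x\<^sup>2 - 2)"
    using secular x2 unfolding n_def[symmetric] a_def[symmetric] E_def[symmetric] by (simp add: divide_simps mult_ac)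
  note U0 = degree_excess(2)[folded U_def]
  define p where "p = (\<lambda>v. max 0 (int (deg v) - 2))"
  have arc: "(int (deg v) - 2) * (int (deg u) - 2) + p v + p u \<ge> 0" if "v \<in> V" "u \<in> N v" for v u
  proof -
    have "0 \<le> i * j + max 0 i + max 0 j" if "i \<ge> -1" "j \<ge> -1" for i j :: int
    proof -
      have "i = -1 \<or> j = -1 \<or> (i \<ge> 0 \<and> j \<ge> 0)" using that by linarith
      then show ?thesis by auto
    qed
    then show ?thesis using deg_pos[OF that] deg_pos'[OF that] by (simp add: p_def)
  qed
  \<comment> \<open>For \<open>k \<ge> 2\<close> the left side is \<open>(k - 2) (k - 3)\<close>; the factor \<open>2\<close> counts each arc from both of its ends.\<close>
  have vertex: "3 * ((int k - 1) * (int k - 2)) - 2 * (int k * max 0 (int k - 2)) \<ge> 0" for k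
  proof (cases "k \<ge> 2")
    case True
    have "3 * ((int k - 1) * (int k - 2)) - 2 * (int k * max 0 (int k - 2)) = (int k - 2) * (int k - 3)"
      using True by (simp add: algebra_simps)
    also have "\<dots> \<ge> 0" using True by (cases "k = 2") auto
    finally show ?thesis .
  next
    case False then have "k = 0 \<or> k = 1" by auto
    then show ?thesis by auto
  qed
  have T: "T = (\<Sum>v\<in>V. \<Sum>u\<in>N v. (int (deg v) - 2) * (int (deg u) - 2)) + 3 * U"
    unfolding arc_sum_shifted by (simp add: T_def)
  have "0 \<le> (\<Sum>v\<in>V. \<Sum>u\<in>N v. (int (deg v) - 2) * (int (deg u) - 2) + p v + p u)"
    by (intro sum_nonneg arc)
  also have "\<dots> = T - (\<Sum>v\<in>V. 3 * ((int (deg v) - 1) * (int (deg v) - 2)) - 2 * (int (deg v) * p v))"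
    unfolding T degree_excess(1)[folded U_def]
    by (simp add: sum.distrib arc_sum_tail arc_sum_head sum_subtractf sum_distrib_left[symmetric] del: sum_constant)
  finally have "T \<ge> (\<Sum>v\<in>V. 3 * ((int (deg v) - 1) * (int (deg v) - 2)) - 2 * (int (deg v) * p v))" by simp
  moreover have "(\<Sum>v\<in>V. 3 * ((int (deg v) - 1) * (int (deg v) - 2)) - 2 * (int (deg v) * p v)) \<ge> 0"
    unfolding p_def by (intro sum_nonneg vertex)
  ultimately have T0: "T \<ge> 0" by linarith
  have W2: "real_of_int walks2 = real_of_int U + 3 * real_of_int walks1 - 2 * n"
    and W3: "real_of_int walks3 = real_of_int T - 3 * real_of_int U + 4 * real_of_int walks2 - 4 * real_of_int walks1"
    by (simp_all add: U_def T_def n_def)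
  have "(x\<^sup>2 - 2) * ((x - 1) * U + T) - a * x =
     (x\<^sup>2 - 2) * (2 * E * (n * (x - 1) + walks1) + (x - 1)\<^sup>2 * walks1
     + 2 * (x - 1) * walks2 + walks3
     - x * (n * (x - 1)\<^sup>2 + 2 * (x - 1) * walks1 + walks2)) - E * (E * (x\<^sup>2 - 2))"
    unfolding W3 W2 w1 sec n_def[symmetric]
    by (simp add: E_def a_def n_def[symmetric] power2_eq_square algebra_simps)
  also have "\<dots> = (x\<^sup>2 - 2) * (2 * E * (n * (x - 1) + walks1) - E\<^sup>2 + (x - 1)\<^sup>2 * walks1
     + 2 * (x - 1) * walks2 + walks3
     - x * (n * (x - 1)\<^sup>2 + 2 * (x - 1) * walks1 + walks2))"
    by (simp add: power2_eq_square algebra_simps)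
  also have "\<dots> \<le> (x\<^sup>2 - 2) * rayleigh_gap x (\<lambda>v. x - 1 + real (deg v))"
    using rayleigh_gap_degree_vector[of E "x - 1" 1 x] x2 unfolding n_def by (intro mult_left_mono) (auto simp: mult_ac)
  finally have gap: "(x\<^sup>2 - 2) * ((x - 1) * U + T) - a * x
    \<le> (x\<^sup>2 - 2) * rayleigh_gap x (\<lambda>v. x - 1 + real (deg v))" .
  have "3 * a \<le> n" "n \<le> x" using x c unfolding a_def n_def by simp_all
  then have a: "3 * a \<le> x" by linarith
  have "3 * (a * x) \<le> x * x" using mult_right_mono[OF a, of x] x by simp
  then have ax: "a * x < x\<^sup>2 - 2" using xx x unfolding power2_eq_square by linarith
  have nn: "0 \<le> (x - 1) * U" using U0 x by simp
  show ?thesis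
  proof (cases "U = 0 \<and> T = 0")
    case True
    have d: "deg v \<in> {1, 2}" if "v \<in> V" for v using degree_excess(3)[folded U_def] True that by blast
    have nonneg: "0 \<le> (int (deg v) - 2) * (int (deg u) - 2)" if "v \<in> V" "u \<in> N v" for u v
      using d[of v] d[of u] that nbr_subset by fastforce
    have "\<not> (deg v = 1 \<and> deg u = 1)" if "v \<in> V" "u \<in> N v" for u v
    proof -
      have "(\<Sum>v\<in>V. \<Sum>u\<in>N v. (int (deg v) - 2) * (int (deg u) - 2)) = 0"
        using True T by simp
      then have "(\<Sum>u\<in>N v. (int (deg v) - 2) * (int (deg u) - 2)) = 0"
        using that fin nonneg by (subst (asm) sum_nonneg_eq_0_iff) (auto intro!: sum_nonneg)
      then have "(int (deg v) - 2) * (int (deg u) - 2) = 0"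
        using that finite_nbr nonneg by (subst (asm) sum_nonneg_eq_0_iff) auto
      then show ?thesis by auto
    qed
    moreover have "rayleigh_gap x (\<lambda>v. x - 1 + real (deg v)) \<ge> 0" if "card V = 4 * c"
    proof -
      have "a = 0" using that by (simp add: a_def n_def)
      then show ?thesis using gap True x2 by (simp add: zero_le_mult_iff)
    qed
    ultimately show ?thesis using d by blast
  next
    case False
    have "1 \<le> (x - 1) * U + T"
    proof (cases "T = 0")
      case True
      have "1 \<le> (x - 1) * 1" using x by simp
      also have "\<dots> \<le> (x - 1) * U" using True False U0 x by (intro mult_left_mono) auto
      finally show ?thesis using True by simp
    next
      case False
      then show ?thesis using T0 nn by linarith
    qed
    then have "x\<^sup>2 - 2 \<le> (x\<^sup>2 - 2) * ((x - 1) * U + T)" using x2 by simp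
    then have "0 < (x\<^sup>2 - 2) * rayleigh_gap x (\<lambda>v. x - 1 + real (deg v))" using gap ax by linarith
    then show ?thesis using x2 by (simp add: zero_less_mult_iff)
  qed
qed

end

section \<open>Graphs whose components are short paths\<close>

definition path_nbrs :: "nat \<Rightarrow> nat \<Rightarrow> nat set" where
  "path_nbrs k i = {j. j < k \<and> (j = Suc i \<or> i = Suc j)}"

lemma path_nbrs_eq: "i < k \<Longrightarrow> path_nbrs k i = (if Suc i < k then {Suc i} else {}) \<union> (if 0 < i then {i - 1} else {})"
  by (auto simp: path_nbrs_def)

lemma card_path_nbrs: "i < k \<Longrightarrow> card (path_nbrs k i) = (if Suc i < k then 1 else 0) + (if 0 < i then 1 else 0)"
  by (cases i) (auto simp: path_nbrs_eq)

lemma sum_card_path_nbrs: "(\<Sum>i<k. card (path_nbrs k i)) = 2 * (k - 1)"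
proof -
  have "(\<Sum>i<k. card (path_nbrs k i)) = (\<Sum>i<k. if Suc i < k then 1 else 0) + (\<Sum>i<k. if 0 < i then 1 else 0)"
    by (simp add: card_path_nbrs sum.distrib)
  also have "(\<Sum>i<k. if Suc i < k then 1 else 0 :: nat) = card {i. i < k \<and> Suc i < k}"
    by (simp add: sum.If_cases Int_def)
  also have "{i. i < k \<and> Suc i < k} = {..<k - 1}" by auto
  also have "(\<Sum>i<k. if 0 < i then 1 else 0 :: nat) = card {i. i < k \<and> 0 < i}"
    by (simp add: sum.If_cases Int_def)
  also have "{i. i < k \<and> 0 < i} = {1..<k}" by auto
  finally show ?thesis by simp
qed

context nbr_graph
begin

text \<open>
  The list runs through a whole connected component that is a path: the neighbourhood of each of its entries
  in the entire graph consists of its neighbours in the list.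
\<close>

definition path_component :: "'a list \<Rightarrow> bool" where
  "path_component p \<longleftrightarrow> p \<noteq> [] \<and> distinct p \<and> set p \<subseteq> V \<and>
     (\<forall>i<length p. N (p ! i) = (!) p ` path_nbrs (length p) i)"

lemma path_component_deg:
  assumes "path_component p" "i < length p"
  shows "deg (p ! i) = (if Suc i < length p then 1 else 0) + (if 0 < i then 1 else 0)"
proof -
  have "inj_on ((!) p) (path_nbrs (length p) i)"
    using assms by (auto simp: path_component_def path_nbrs_def inj_on_def nth_eq_iff_index_eq)
  then have "deg (p ! i) = card (path_nbrs (length p) i)"
    using assms by (auto simp: path_component_def card_image)
  then show ?thesis using assms by (simp add: card_path_nbrs)
qed

lemma path_component_nbr:
  assumes "path_component p" "Suc i < length p"
  shows "p ! Suc i \<in> N (p ! i)" "p ! i \<in> N (p ! Suc i)"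
  using assms by (auto simp: path_component_def path_nbrs_def)

lemma path_component_closed:
  assumes "path_component p" "v \<in> set p" shows "N v \<subseteq> set p"
  using assms by (auto simp: path_component_def path_nbrs_def in_set_conv_nth)

text \<open>
  A path component is connected, so a union of components that meets it contains it.
\<close>

lemma path_component_subset:
  assumes p: "path_component p" and v: "v \<in> set p" "v \<in> W" and W: "\<And>u. u \<in> W \<Longrightarrow> N u \<subseteq> W"
  shows "set p \<subseteq> W"
proof -
  obtain i where i: "i < length p" "p ! i = v" using v by (auto simp: in_set_conv_nth)
  have step: "p ! j \<in> W \<longleftrightarrow> p ! Suc j \<in> W" if "Suc j < length p" for j
    using path_component_nbr[OF p that] W by blast
  have zero: "j < length p \<Longrightarrow> p ! j \<in> W \<longleftrightarrow> p ! 0 \<in> W" for j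
    by (induction j) (auto dest: step)
  show ?thesis using zero i v by (metis in_set_conv_nth subsetI)
qed

text \<open>
  The components are split off one at a time; what remains is still closed under taking neighbours.
\<close>

lemma ex_path_partition:
  assumes "\<And>v. v \<in> V \<Longrightarrow> \<exists>p. path_component p \<and> v \<in> set p"
  shows "\<exists>ps. (\<forall>p\<in>set ps. path_component p) \<and> distinct (concat ps) \<and> set (concat ps) = V"
proof -
  have "\<exists>ps. (\<forall>p\<in>set ps. path_component p) \<and> distinct (concat ps) \<and> set (concat ps) = W"
    if "finite W" "W \<subseteq> V" "\<And>u. u \<in> W \<Longrightarrow> N u \<subseteq> W" for W
    using that
  proof (induction W rule: finite_psubset_induct)
    case (psubset W)
    show ?case
    proof (cases "W = {}")
      case True
      then show ?thesis by (intro exI[of _ "[]"]) auto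
    next
      case False
      then obtain v where v: "v \<in> W" by blast
      then obtain p where p: "path_component p" "v \<in> set p" using assms psubset.prems by blast
      have sub: "set p \<subseteq> W" by (rule path_component_subset[OF p v psubset.prems(2)])
      have "N u \<subseteq> W - set p" if u: "u \<in> W - set p" for u
      proof -
        have "w \<notin> set p" if "w \<in> N u" for w
          using path_component_closed[OF p(1), of w] nbr_sym[of u w] u that psubset.prems(1) by blast
        then show ?thesis using psubset.prems(2)[of u] u by blast
      qed
      then obtain ps where "\<forall>p\<in>set ps. path_component p" "distinct (concat ps)" "set (concat ps) = W - set p"
        using psubset.IH[of "W - set p"] psubset.prems p v by blast
      moreover have "distinct p" using p by (simp add: path_component_def)
      ultimately show ?thesis using p sub by (intro exI[of _ "p # ps"]) auto
    qed
  qed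
  from this[OF fin] show ?thesis using nbr_subset by blast
qed

text \<open>
  A path of order \<open>k\<close> has \<open>k - 1\<close> edges, so the number of edges determines the number of paths.
\<close>

lemma walks1_path_partition:
  assumes ps: "\<forall>p\<in>set ps. path_component p" "distinct (concat ps)" "set (concat ps) = V"
  shows "walks1 = 2 * (int (card V) - int (length ps))" and "card V = sum_list (map length ps)"
proof -
  show card: "card V = sum_list (map length ps)"
    using distinct_card[OF ps(2)] unfolding ps(3) by (simp add: length_concat)
  have path: "sum_list (map deg p) = 2 * (length p - 1)" if "path_component p" for p
  proof -
    have "sum_list (map deg p) = (\<Sum>i<length p. deg (p ! i))"
      by (simp add: sum_list_sum_nth atLeast0LessThan)
    also have "\<dots> = (\<Sum>i<length p. card (path_nbrs (length p) i))"
      using path_component_deg[OF that] by (intro sum.cong) (auto simp: card_path_nbrs)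
    finally show ?thesis by (simp add: sum_card_path_nbrs)
  qed
  have "sum_list (map int (map length ps)) - int (length ps) = sum_list (map (\<lambda>p. int (length p - 1)) ps)"
    using ps(1) by (induction ps) (auto simp: path_component_def Suc_le_eq of_nat_diff)
  moreover have "walks1 = int (sum_list (map deg (concat ps)))"
    unfolding sum_list_distinct_conv_sum_set[OF ps(2)] ps(3) walks1_def by simp
  moreover have "sum_list (map deg (concat ps)) = sum_list (map (\<lambda>p. 2 * (length p - 1)) ps)"
    using ps(1) by (induction ps) (auto simp: path)
  moreover have "int (sum_list (map (\<lambda>p. 2 * (length p - 1)) ps)) = 2 * sum_list (map (\<lambda>p. int (length p - 1)) ps)"
    by (induction ps) auto
  moreover have "int (sum_list (map length ps)) = sum_list (map int (map length ps))"
    by (induction ps) auto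
  ultimately show "walks1 = 2 * (int (card V) - int (length ps))" using card by simp
qed

lemma path_component_1: "v \<in> V \<Longrightarrow> N v = {} \<Longrightarrow> path_component [v]"
  by (simp add: path_component_def path_nbrs_eq)

lemma path_component_2:
  "a \<in> V \<Longrightarrow> b \<in> V \<Longrightarrow> a \<noteq> b \<Longrightarrow> N a = {b} \<Longrightarrow> N b = {a} \<Longrightarrow> path_component [a, b]"
  unfolding path_component_def by (auto simp: path_nbrs_eq less_Suc_eq)

lemma path_component_3:
  "{a, b, c} \<subseteq> V \<Longrightarrow> distinct [a, b, c] \<Longrightarrow> N a = {b} \<Longrightarrow> N b = {a, c} \<Longrightarrow> N c = {b} \<Longrightarrow>
    path_component [a, b, c]"
  unfolding path_component_def by (auto simp: path_nbrs_eq less_Suc_eq)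

lemma path_component_4:
  "{a, b, c, e} \<subseteq> V \<Longrightarrow> distinct [a, b, c, e] \<Longrightarrow> N a = {b} \<Longrightarrow> N b = {a, c} \<Longrightarrow> N c = {b, e} \<Longrightarrow>
    N e = {c} \<Longrightarrow> path_component [a, b, c, e]"
  unfolding path_component_def by (auto simp: path_nbrs_eq less_Suc_eq)

lemma nbrs_1:
  assumes "v \<in> V" "deg v = 1" "u \<in> N v" shows "N v = {u}"
  using assms by (metis card_1_singletonE singletonD)

lemma nbrs_2:
  assumes "v \<in> V" "deg v = 2" "u \<in> N v" obtains w where "N v = {u, w}" "u \<noteq> w"
  using assms by (metis card_2_iff insert_commute insertE singletonD)

text \<open>
  A vertex of degree \<open>2\<close> with at most one neighbour of degree \<open>2\<close> is adjacent to a leaf. This rules out cycles, and a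
  path that starts at a leaf ends after at most four vertices.
\<close>

lemma ex_path_component:
  assumes deg2: "\<And>v. v \<in> V \<Longrightarrow> deg v \<le> 2"
    and nbr2: "\<And>v u w. v \<in> V \<Longrightarrow> deg v = 2 \<Longrightarrow> u \<in> N v \<Longrightarrow> w \<in> N v \<Longrightarrow> deg u = 2 \<Longrightarrow> deg w = 2 \<Longrightarrow> u = w"
    and v: "v \<in> V"
  shows "\<exists>p. path_component p \<and> v \<in> set p"
proof -
  have deg1: "deg u = 1 \<or> deg u = 2" if "u \<in> V" "w \<in> N u" for u w
    using deg2[OF that(1)] deg_pos[OF that] by linarith
  have leaf: "\<exists>p. path_component p \<and> a \<in> set p" if a: "a \<in> V" "deg a = 1" for a
  proof -
    obtain b where Na: "N a = {b}" using a by (metis card_1_singletonE)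
    have b: "b \<in> V" "a \<in> N b" using Na a nbr_subset nbr_sym by blast+
    have ab: "a \<noteq> b" using Na nbr_irrefl by blast
    show ?thesis
    proof (cases "deg b = 1")
      case True
      then have "N b = {a}" using nbrs_1 b by blast
      then show ?thesis using path_component_2[of a b] a b ab Na by (intro exI[of _ "[a, b]"]) auto
    next
      case False
      then have db: "deg b = 2" using deg1 b by blast
      obtain c where Nb: "N b = {a, c}" "a \<noteq> c" by (rule nbrs_2[OF b(1) db b(2)])
      have c: "c \<in> V" "b \<in> N c" using Nb b nbr_subset nbr_sym by blast+
      have bc: "b \<noteq> c" using Nb nbr_irrefl by blast
      show ?thesis
      proof (cases "deg c = 1")
        case True
        then have "N c = {b}" using nbrs_1 c by blast
        then show ?thesis using path_component_3[of a b c] a b c ab bc Na Nb by (intro exI[of _ "[a, b, c]"]) auto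
      next
        case False
        then have dc: "deg c = 2" using deg1 c by blast
        obtain e where Nc: "N c = {b, e}" "b \<noteq> e" by (rule nbrs_2[OF c(1) dc c(2)])
        have e: "e \<in> V" "c \<in> N e" using Nc c nbr_subset nbr_sym by blast+
        have "deg e \<noteq> 2" using nbr2[of c b e] Nc c dc db by blast
        then have "N e = {c}" using nbrs_1 e deg1 by blast
        moreover have "c \<noteq> e" using Nc nbr_irrefl by blast
        moreover have "a \<noteq> e" using Na e bc by auto
        ultimately show ?thesis using path_component_4[of a b c e] a b c e ab bc Na Nb Nc
          by (intro exI[of _ "[a, b, c, e]"]) auto
      qed
    qed
  qed
  consider "deg v = 0" | "deg v = 1" | "deg v = 2" using deg2[OF v] by linarith
  then show ?thesis
  proof cases
    case 1
    then have "N v = {}" using finite_nbr[OF v] by simp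
    then show ?thesis using path_component_1[OF v] by (intro exI[of _ "[v]"]) auto
  next
    case 2
    then show ?thesis using leaf v by blast
  next
    case 3
    then obtain u w where Nv: "N v = {u, w}" "u \<noteq> w" by (metis card_2_iff)
    have "\<exists>z\<in>N v. deg z = 1"
      using nbr2[OF v 3, of u w] deg1[of u v] deg1[of w v] Nv v nbr_subset nbr_sym by blast
    then obtain z where z: "z \<in> N v" "deg z = 1" by blast
    then have "z \<in> V" "v \<in> N z" using v nbr_subset nbr_sym by blast+
    then show ?thesis using leaf[of z] z path_component_closed by blast
  qed
qed

lemma path_component_length_1:
  assumes "path_component p" "length p = 1" shows "\<exists>v\<in>V. deg v = 0"
  using path_component_deg[OF assms(1), of 0] assms nth_mem[of 0 p]
  by (intro bexI[of _ "p ! 0"]) (auto simp: path_component_def)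

lemma path_component_length_2:
  assumes "path_component p" "length p = 2" shows "\<exists>v\<in>V. \<exists>u\<in>N v. deg v = 1 \<and> deg u = 1"
  using path_component_deg[OF assms(1), of 0] path_component_deg[OF assms(1), of 1]
    path_component_nbr(1)[OF assms(1), of 0] assms nth_mem[of 0 p]
  by (intro bexI[of _ "p ! 0"] bexI[of _ "p ! 1"]) (auto simp: path_component_def)

lemma path_component_length_ge_3:
  assumes "path_component p" "length p \<ge> 3" shows "\<exists>v\<in>V. deg v = 2"
  using path_component_deg[OF assms(1), of 1] assms nth_mem[of 1 p]
  by (intro bexI[of _ "p ! 1"]) (auto simp: path_component_def)

lemma path_component_length_ge_4:
  assumes "path_component p" "length p \<ge> 4" shows "\<exists>v\<in>V. \<exists>u\<in>N v. deg v = 2 \<and> deg u = 2"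
  using path_component_deg[OF assms(1), of 1] path_component_deg[OF assms(1), of 2]
    path_component_nbr(1)[OF assms(1), of 1] assms nth_mem[of 1 p]
  by (intro bexI[of _ "p ! 1"] bexI[of _ "p ! 2"]) (auto simp: path_component_def numeral_2_eq_2)

lemma path_component_length_ge_5:
  assumes "path_component p" "length p \<ge> 5"
  shows "\<exists>v\<in>V. deg v = 2 \<and> (\<exists>u\<in>N v. \<exists>w\<in>N v. u \<noteq> w \<and> deg u = 2 \<and> deg w = 2)"
proof -
  have "Suc 1 < length p" "Suc 2 < length p" "1 < length p" "2 < length p" "3 < length p" using assms(2) by auto
  note l = this
  have "p ! 2 \<in> V" using l assms(1) by (auto simp: path_component_def)
  moreover have "p ! 1 \<in> N (p ! 2)" "p ! 3 \<in> N (p ! 2)"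
    using path_component_nbr(2)[OF assms(1) l(1)] path_component_nbr(1)[OF assms(1) l(2)]
    by (simp_all add: numeral_2_eq_2 numeral_3_eq_3)
  moreover have "p ! 1 \<noteq> p ! 3" using l assms(1) by (auto simp: path_component_def nth_eq_iff_index_eq)
  moreover have "deg (p ! 2) = 2" "deg (p ! 1) = 2" "deg (p ! 3) = 2"
    using l path_component_deg[OF assms(1)] assms(2) by auto
  ultimately show ?thesis by blast
qed

end

context nbr_graph
begin

text \<open>
  In each of the following three cases the degree conditions confine the orders of the paths to two consecutive values,
  since a path that is too short or too long contains a forbidden vertex or a forbidden pair of adjacent vertices.
\<close>

lemma path_partition_if_degree_le_1:
  assumes "\<forall>v\<in>V. deg v \<le> 1"
  shows "\<exists>ps. (\<forall>p\<in>set ps. path_component p \<and> length p \<in> {1, Suc 1}) \<and>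
    distinct (concat ps) \<and> set (concat ps) = V"
proof -
  have "\<exists>p. path_component p \<and> v \<in> set p" if "v \<in> V" for v
  proof (rule ex_path_component[OF _ _ that])
    show "deg v \<le> 2" if "v \<in> V" for v using assms that by fastforce
    show "u = w" if "v \<in> V" "deg v = 2" for u v w using assms that by fastforce
  qed
  then have "\<exists>ps. (\<forall>p\<in>set ps. path_component p) \<and> distinct (concat ps) \<and> set (concat ps) = V"
    by (rule ex_path_partition)
  moreover have "length p \<in> {1, Suc 1}" if "path_component p" for p
  proof -
    have "\<not> 3 \<le> length p" using path_component_length_ge_3[OF that] assms by fastforce
    moreover have "length p \<noteq> 0" using that by (auto simp: path_component_def)
    ultimately have "length p = 1 \<or> length p = Suc 1" by linarith
    then show ?thesis by simp
  qed
  ultimately show ?thesis by blast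
qed

lemma path_partition_if_degree_2_independent:
  assumes "\<forall>v\<in>V. deg v \<in> {1, 2} \<and> (\<forall>u\<in>N v. \<not> (deg v = 2 \<and> deg u = 2))"
  shows "\<exists>ps. (\<forall>p\<in>set ps. path_component p \<and> length p \<in> {2, Suc 2}) \<and>
    distinct (concat ps) \<and> set (concat ps) = V"
proof -
  have "\<exists>p. path_component p \<and> v \<in> set p" if "v \<in> V" for v
  proof (rule ex_path_component[OF _ _ that])
    show "deg v \<le> 2" if "v \<in> V" for v using assms that by fastforce
    show "u = w" if "v \<in> V" "deg v = 2" "u \<in> N v" "deg u = 2" for u v w using assms that by blast
  qed
  then have "\<exists>ps. (\<forall>p\<in>set ps. path_component p) \<and> distinct (concat ps) \<and> set (concat ps) = V"
    by (rule ex_path_partition)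
  moreover have "length p \<in> {2, Suc 2}" if "path_component p" for p
  proof -
    have "\<not> 4 \<le> length p" using path_component_length_ge_4[OF that] assms by blast
    moreover have "length p \<noteq> 1" using path_component_length_1[OF that] assms by fastforce
    moreover have "length p \<noteq> 0" using that by (auto simp: path_component_def)
    ultimately have "length p = 2 \<or> length p = Suc 2" by linarith
    then show ?thesis by simp
  qed
  ultimately show ?thesis by blast
qed

lemma path_partition_if_leaves_independent:
  assumes d: "\<forall>v\<in>V. deg v \<in> {1, 2} \<and> (\<forall>u\<in>N v. \<not> (deg v = 1 \<and> deg u = 1))"
    and nbr2: "\<And>v u w. v \<in> V \<Longrightarrow> deg v = 2 \<Longrightarrow> u \<in> N v \<Longrightarrow> w \<in> N v \<Longrightarrow> deg u = 2 \<Longrightarrow> deg w = 2 \<Longrightarrow> u = w"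
  shows "\<exists>ps. (\<forall>p\<in>set ps. path_component p \<and> length p \<in> {3, Suc 3}) \<and>
    distinct (concat ps) \<and> set (concat ps) = V"
proof -
  have "\<exists>p. path_component p \<and> v \<in> set p" if "v \<in> V" for v
    by (rule ex_path_component[OF _ nbr2 that]) (use d in force)
  then have "\<exists>ps. (\<forall>p\<in>set ps. path_component p) \<and> distinct (concat ps) \<and> set (concat ps) = V"
    by (rule ex_path_partition)
  moreover have "length p \<in> {3, Suc 3}" if "path_component p" for p
  proof -
    have "\<not> 5 \<le> length p" using path_component_length_ge_5[OF that] nbr2 by blast
    moreover have "length p \<noteq> 1" using path_component_length_1[OF that] d by fastforce
    moreover have "length p \<noteq> 2" using path_component_length_2[OF that] d by blast
    moreover have "length p \<noteq> 0" using that by (auto simp: path_component_def)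
    ultimately have "length p = 3 \<or> length p = Suc 3" by linarith
    then show ?thesis by simp
  qed
  ultimately show ?thesis by blast
qed

text \<open>
  The arcs between vertices of degree \<open>2\<close> are counted by the sum of \<open>(d(u) - 1) (d(v) - 1)\<close> over all arcs. If no two
  leaves are adjacent, this sum is \<open>3 W - 4 n\<close> for the number \<open>W\<close> of arcs, and a vertex of degree \<open>2\<close> with two
  neighbours of degree \<open>2\<close> contributes at least four such arcs.
\<close>

lemma adjacent_degree_2_count:
  assumes d: "\<forall>v\<in>V. deg v \<in> {1, 2} \<and> (\<forall>u\<in>N v. \<not> (deg v = 1 \<and> deg u = 1))"
    and v: "v \<in> V" "deg v = 2" and u: "u \<in> N v" "deg u = 2" and w: "w \<in> N v" "deg w = 2" and ne: "u \<noteq> w"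
  shows "4 \<le> 3 * walks1 - 4 * int (card V)"
proof -
  have d12: "deg x = 1 \<or> deg x = 2" if "x \<in> V" for x using d that by blast
  have w2: "walks2 - 3 * walks1 + 2 * int (card V) = 0"
    unfolding degree_excess(1) by (intro sum.neutral) (use d12 in fastforce)
  have "(\<Sum>v\<in>V. \<Sum>u\<in>N v. (int (deg v) - 2) * (int (deg u) - 2)) = 0"
    by (intro sum.neutral ballI) (use d d12 nbr_subset in fastforce)
  then have w3: "walks3 - 4 * walks2 + 4 * walks1 = 0" unfolding arc_sum_shifted by simp
  define r where "r = (\<lambda>v. \<Sum>u\<in>N v. (int (deg v) - 1) * (int (deg u) - 1))"
  have nonneg: "0 \<le> (int (deg x) - 1) * (int (deg y) - 1)" if "x \<in> V" "y \<in> N x" for x y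
    using deg_pos[OF that] deg_pos'[OF that] by simp
  have r0: "0 \<le> r x" if "x \<in> V" for x unfolding r_def by (intro sum_nonneg nonneg that)
  have uw: "u \<in> V" "w \<in> V" "v \<in> N u" "v \<in> N w" using u w v nbr_subset nbr_sym by blast+
  have dist: "u \<noteq> v" "w \<noteq> v" using u w nbr_irrefl by blast+
  have "(\<Sum>y\<in>{u, w}. (int (deg v) - 1) * (int (deg y) - 1)) \<le> r v"
    unfolding r_def using v u w finite_nbr by (intro sum_mono2 nonneg) auto
  then have rv: "2 \<le> r v" using ne v u w by simp
  have r1: "1 \<le> r x" if "x \<in> V" "deg x = 2" "v \<in> N x" for x
  proof -
    have "(int (deg x) - 1) * (int (deg v) - 1) \<le> r x"
      unfolding r_def using that finite_nbr by (intro member_le_sum nonneg) auto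
    then show ?thesis using that v by simp
  qed
  have "(\<Sum>x\<in>{v, u, w}. r x) \<le> (\<Sum>x\<in>V. r x)"
    using fin v uw r0 by (intro sum_mono2) auto
  moreover have "(\<Sum>x\<in>{v, u, w}. r x) = r v + r u + r w" using ne dist by auto
  ultimately have "4 \<le> (\<Sum>x\<in>V. r x)" using rv r1[OF uw(1) u(2) uw(3)] r1[OF uw(2) w(2) uw(4)] by linarith
  then show ?thesis using w2 w3 unfolding r_def arc_sum_shifted by simp
qed

text \<open>
  If the largest eigenvalue of \<open>J + A\<close> does not exceed \<open>x\<close>, then the test vector maximises the Rayleigh quotient
  and is an eigenvector. At a vertex with two neighbours of degree \<open>2\<close> the eigenvalue equation would read
  \<open>x (x + 1) = S + 2 (x + 1)\<close> for the entry sum \<open>S\<close>, but \<open>S = x\<^sup>2 - x - 1\<close> by the secular equation.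
\<close>

lemma P4_degree_vector_eigen:
  fixes x :: real
  assumes d: "\<forall>v\<in>V. deg v \<in> {1, 2} \<and> (\<forall>u\<in>N v. \<not> (deg v = 1 \<and> deg u = 1))"
    and w1: "walks1 = 2 * (int (card V) - int c)" and n: "card V = 4 * c"
    and secular: "c * ((4 * x + 2) / (x\<^sup>2 - x - 1)) = 1"
    and gap: "rayleigh_gap x (\<lambda>v. x - 1 + real (deg v)) \<ge> 0"
    and quad: "\<And>y. quad_form V (truncated_dist N) y \<le> (x - 1) * (\<Sum>v\<in>V. (y v)\<^sup>2)"
    and v: "v \<in> V" "deg v = 2" and u: "u \<in> N v" "deg u = 2" and w: "w \<in> N v" "deg w = 2"
  shows "u = w"
proof (rule ccontr)
  assume ne: "u \<noteq> w"
  let ?L = "\<lambda>u v. if u = v then 0 else if v \<in> N u then 2 else 1 :: real"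
  let ?y = "\<lambda>v. x - 1 + real (deg v)"
  have sym: "?L a b = ?L b a" if "a \<in> V" "b \<in> V" for a b using nbr_sym that by auto
  have ge: "(x - 1) * (\<Sum>v\<in>V. (?y v)\<^sup>2) \<le> quad_form V ?L ?y"
    unfolding quad_form_distance_lower[of _ x] using gap by simp
  have eig: "(\<Sum>b\<in>V. ?L v b * ?y b) = (x - 1) * ?y v"
    by (rule quad_form_max_imp_eigen[OF fin sym quad ge v(1)])
  have Nv: "N v = {u, w}"
    using card_subset_eq[of "N v" "{u, w}"] finite_nbr[OF v(1)] u w v ne by (metis card_2_iff empty_subsetI insert_subset)
  have "(\<Sum>b\<in>V. ?L v b * ?y b) = (\<Sum>b\<in>V. ?y b + (if b \<in> N v then ?y b else 0) - (if b = v then ?y b else 0))"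
    by (intro sum.cong) (auto simp: nbr_irrefl)
  also have "\<dots> = (\<Sum>b\<in>V. ?y b) + (\<Sum>b\<in>V. if b \<in> N v then ?y b else 0) - ?y v"
    using fin v by (simp add: sum.distrib sum_subtractf)
  also have "(\<Sum>b\<in>V. if b \<in> N v then ?y b else 0) = (\<Sum>b\<in>{b\<in>V. b \<in> N v}. ?y b)"
    by (rule sum.inter_filter[OF fin, symmetric])
  also have "{b\<in>V. b \<in> N v} = {u, w}" using Nv nbr_subset[OF v(1)] by auto
  also have "(\<Sum>b\<in>{u, w}. ?y b) = 2 * (x + 1)" using ne u w by simp
  also have "(\<Sum>b\<in>V. ?y b) = real (card V) * (x - 1) + real_of_int walks1"
    by (simp add: walks1_def sum.distrib)
  also have "\<dots> = c * (4 * x + 2)" unfolding w1 n by (simp add: algebra_simps)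
  finally have "c * (4 * x + 2) + 2 * (x + 1) = x * (x + 1)"
    using eig v by (simp add: algebra_simps)
  moreover have "c * (4 * x + 2) = x\<^sup>2 - x - 1"
    using secular by (cases "x\<^sup>2 - x - 1 = 0") (simp_all add: field_simps)
  ultimately show False by (simp add: power2_eq_square algebra_simps)
qed

end

section \<open>The non-adjacency graph\<close>

text \<open>
  These are the neighbourhoods of the complement graph, used to instantiate \<open>nbr_graph\<close>.
\<close>

definition non_nbrs :: "'a pair_pre_digraph \<Rightarrow> 'a \<Rightarrow> 'a set" where
  "non_nbrs G v = {u \<in> pverts G. u \<noteq> v \<and> (v, u) \<notin> parcs G}"

lemma (in pair_graph) arcs_sym: "(u, v) \<in> parcs G \<longleftrightarrow> (v, u) \<in> parcs G"
  using pair_sym_arcs by (auto simp: symmetric_def sym_def)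

lemma (in pair_graph) nbr_graph_non_nbrs: "nbr_graph (pverts G) (non_nbrs G)"
  using pair_finite_verts arcs_sym by unfold_locales (auto simp: non_nbrs_def)

lemma (in pair_graph) sum_card_non_nbrs:
  "(\<Sum>v\<in>pverts G. int (card (non_nbrs G v))) =
    int (card (pverts G)) * (int (card (pverts G)) - 1) - 2 * int (card (edges G))"
proof -
  have fin: "finite (pverts G)" by (rule pair_finite_verts)
  have "int (card (non_nbrs G v)) = int (card (pverts G)) - 1 - int (card {u. (v, u) \<in> parcs G})"
    if "v \<in> pverts G" for v
  proof -
    have "pverts G = insert v (non_nbrs G v \<union> {u. (v, u) \<in> parcs G})"
      using that in_arcsD2 by (auto simp: non_nbrs_def)
    moreover have "finite (non_nbrs G v)" using fin by (simp add: non_nbrs_def)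
    moreover have sub: "finite {u. (v, u) \<in> parcs G}"
      by (rule finite_subset[OF _ fin]) (auto dest: in_arcsD2)
    moreover have "v \<notin> non_nbrs G v \<union> {u. (v, u) \<in> parcs G}"
      using pair_no_loops[of "(v, v)"] by (auto simp: non_nbrs_def)
    moreover have "non_nbrs G v \<inter> {u. (v, u) \<in> parcs G} = {}" by (auto simp: non_nbrs_def)
    ultimately have "card (pverts G) = Suc (card (non_nbrs G v) + card {u. (v, u) \<in> parcs G})"
      by (metis card_Un_disjoint card_insert_disjoint finite_Un)
    then show ?thesis by simp
  qed
  then have "(\<Sum>v\<in>pverts G. int (card (non_nbrs G v))) =
    (\<Sum>v\<in>pverts G. int (card (pverts G)) - 1 - int (card {u. (v, u) \<in> parcs G}))"
    by (rule sum.cong[OF refl])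
  also have "\<dots> = int (card (pverts G)) * (int (card (pverts G)) - 1) - int (\<Sum>v\<in>pverts G. card {u. (v, u) \<in> parcs G})"
    by (simp add: sum_subtractf)
  also have "(\<Sum>v\<in>pverts G. card {u. (v, u) \<in> parcs G}) = card (SIGMA v:pverts G. {u. (v, u) \<in> parcs G})"
    using fin by (subst card_SigmaI) (auto intro: finite_subset[OF _ fin] dest: in_arcsD2)
  also have "(SIGMA v:pverts G. {u. (v, u) \<in> parcs G}) = parcs G" by (auto dest: in_arcsD1)
  finally show ?thesis by (simp add: card_parcs)
qed

text \<open>
  The truncated distances are entrywise lower bounds for the distances. Passing to absolute values extends the comparison
  of quadratic forms from nonnegative vectors to all vectors.
\<close>

lemma (in pair_graph) nonadjacency_quad_form_le:
  assumes conn: "Digraph_Component.connected (with_proj G)"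
  shows "quad_form (pverts G) (truncated_dist (non_nbrs G)) y
    \<le> distance_spectral_radius G * (\<Sum>v\<in>pverts G. (y v)\<^sup>2)"
proof -
  let ?L = "\<lambda>u v. if u = v then 0 else if v \<in> non_nbrs G u then 2 else 1 :: real"
  have le: "?L u v \<le> dist_mat G u v" if uv: "u \<in> pverts G" "v \<in> pverts G" for u v
  proof -
    obtain p where p: "apath u p v" by (rule connected_imp_apath[OF conn uv])
    show ?thesis
      using graph_dist_ge_1[OF p] graph_dist_ge_2[OF p] uv by (auto simp: non_nbrs_def)
  qed
  have ne: "pverts G \<noteq> {}" using conn by (simp add: connected_conv)
  have "quad_form (pverts G) ?L y \<le> quad_form (pverts G) (dist_mat G) (\<lambda>v. \<bar>y v\<bar>)"
    unfolding quad_form_def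
  proof (intro sum_mono)
    fix u v assume uv: "u \<in> pverts G" "v \<in> pverts G"
    have "?L u v * y u * y v \<le> ?L u v * (\<bar>y u\<bar> * \<bar>y v\<bar>)"
      unfolding mult.assoc abs_mult[symmetric] by (intro mult_left_mono) auto
    also have "\<dots> \<le> dist_mat G u v * (\<bar>y u\<bar> * \<bar>y v\<bar>)"
      using le[OF uv] by (intro mult_right_mono) auto
    finally show "?L u v * y u * y v \<le> dist_mat G u v * \<bar>y u\<bar> * \<bar>y v\<bar>" by (simp add: mult_ac)
  qed
  also have "\<dots> \<le> distance_spectral_radius G * (\<Sum>v\<in>pverts G. \<bar>y v\<bar>\<^sup>2)"
    by (rule distance_spectral_radius_rayleigh[OF pair_finite_verts ne]) (rule graph_dist_commute)
  finally show ?thesis by simp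
qed

text \<open>
  As arcs are pairs of vertices, the action of an isomorphism on arcs is determined by its action on vertices.
\<close>

lemma digraph_iso_with_proj_iff:
  assumes "pair_wf_digraph G"
  shows "digraph_iso (with_proj G) (with_proj H) \<longleftrightarrow>
    (\<exists>f. inj_on f (pverts G) \<and> pverts H = f ` pverts G \<and> parcs H = (\<lambda>(u, v). (f u, f v)) ` parcs G)"
    (is "?L \<longleftrightarrow> ?R")
proof
  interpret pair_wf_digraph G by fact
  assume ?L
  then obtain h where h: "digraph_isomorphism h" "with_proj H = app_iso h (with_proj G)"
    unfolding digraph_iso_def by blast
  have tail: "iso_tail h = fst" and head: "iso_head h = snd"
    using arg_cong[OF h(2), of tail] arg_cong[OF h(2), of head] by simp_all
  have arc: "iso_arcs h a = (\<lambda>(u, v). (iso_verts h u, iso_verts h v)) a" if "a \<in> parcs G" for a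
    using iso_verts_tail[OF h(1), of a] iso_verts_head[OF h(1), of a] that unfolding tail head
    by (simp add: prod_eq_iff split: prod.splits)
  have "pverts H = iso_verts h ` pverts G" using arg_cong[OF h(2), of verts] by simp
  moreover have "parcs H = iso_arcs h ` parcs G" using arg_cong[OF h(2), of arcs] by simp
  moreover have "iso_arcs h ` parcs G = (\<lambda>(u, v). (iso_verts h u, iso_verts h v)) ` parcs G"
    using arc by (rule image_cong[OF refl])
  moreover have "inj_on (iso_verts h) (pverts G)" using digraph_isomorphism_inj_on_verts[OF h(1)] by simp
  ultimately show ?R by (intro exI[of _ "iso_verts h"]) simp
next
  interpret pair_wf_digraph G by fact
  assume ?R
  then obtain f where f: "inj_on f (pverts G)" "pverts H = f ` pverts G"
    "parcs H = (\<lambda>(u, v). (f u, f v)) ` parcs G" by blast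
  define h where "h = \<lparr>iso_verts = f, iso_arcs = (\<lambda>(u, v). (f u, f v)), iso_head = snd, iso_tail = fst\<rparr>"
  have "inj_on (\<lambda>(u, v). (f u, f v)) (parcs G)"
    using f(1) by (auto simp: inj_on_def dest: in_arcsD1 in_arcsD2)
  then have "digraph_isomorphism h"
    using f(1) wf_digraph_axioms by (auto simp: digraph_isomorphism_def h_def wf_digraph)
  moreover have "with_proj H = app_iso h (with_proj G)"
    using f by (simp add: with_proj_def app_iso_def h_def)
  ultimately show ?L unfolding digraph_iso_def by blast
qed

text \<open>
  In diameter at most \<open>2\<close> every distance is determined by equality, adjacency and common neighbours, all of which an
  isomorphism preserves.
\<close>

lemma distance_spectral_radius_iso:
  assumes G: "pair_graph G" and H: "pair_graph H" and iso: "digraph_iso (with_proj G) (with_proj H)"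
    and diam: "\<And>a b. a \<in> pverts H \<Longrightarrow> b \<in> non_nbrs H a \<Longrightarrow> \<exists>w. (a, w) \<in> parcs H \<and> (w, b) \<in> parcs H"
  shows "distance_spectral_radius G = distance_spectral_radius H"
proof -
  interpret G: pair_graph G by fact
  interpret H: pair_graph H by fact
  obtain f where f: "inj_on f (pverts G)" "pverts H = f ` pverts G"
    "parcs H = (\<lambda>(u, v). (f u, f v)) ` parcs G"
    using iso unfolding digraph_iso_with_proj_iff[OF G.pair_wf_digraph_axioms] by blast
  have arc: "(f u, f v) \<in> parcs H \<longleftrightarrow> (u, v) \<in> parcs G" if "u \<in> pverts G" "v \<in> pverts G" for u v
  proof
    assume "(f u, f v) \<in> parcs H"
    then obtain a b where ab: "(a, b) \<in> parcs G" "f u = f a" "f v = f b" using f(3) by auto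
    then have "u = a" "v = b" using f(1) that by (meson G.in_arcsD1 G.in_arcsD2 inj_onD)+
    then show "(u, v) \<in> parcs G" using ab by simp
  qed (use f(3) in auto)
  have dist: "graph_dist G u v = graph_dist H (f u) (f v)" if uv: "u \<in> pverts G" "v \<in> pverts G" for u v
  proof -
    consider "u = v" | "(u, v) \<in> parcs G" | "u \<noteq> v" "(u, v) \<notin> parcs G" by blast
    then show ?thesis
    proof cases
      case 1
      then show ?thesis using uv f(2) by (simp add: G.graph_dist_self H.graph_dist_self)
    next
      case 2
      then show ?thesis using arc[OF uv] by (simp add: G.graph_dist_eq_1 H.graph_dist_eq_1)
    next
      case 3
      have ne: "f u \<noteq> f v" using 3(1) f(1) uv by (auto dest: inj_onD)
      have na: "(f u, f v) \<notin> parcs H" using 3(2) arc[OF uv] by simp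
      obtain w where w: "(f u, w) \<in> parcs H" "(w, f v) \<in> parcs H"
        using diam[of "f u" "f v"] uv f(2) ne na by (auto simp: non_nbrs_def)
      obtain w' where w': "w = f w'" "w' \<in> pverts G" using H.in_arcsD2[OF w(1)] f(2) by blast
      have "(u, w') \<in> parcs G" "(w', v) \<in> parcs G" using w w' arc uv by simp_all
      then have "graph_dist G u v = 2" by (rule G.graph_dist_eq_2[OF _ _ 3])
      moreover have "graph_dist H (f u) (f v) = 2" by (rule H.graph_dist_eq_2[OF w ne na])
      ultimately show ?thesis by simp
    qed
  qed
  have sum_f: "(\<Sum>b\<in>pverts H. g b) = (\<Sum>v\<in>pverts G. g (f v))" for g :: "_ \<Rightarrow> real"
    unfolding f(2) by (simp add: sum.reindex[OF f(1)])
  have "k \<in> spectrum (distance_matrix G) \<longleftrightarrow> k \<in> spectrum (distance_matrix H)" for k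
  proof
    assume "k \<in> spectrum (distance_matrix H)"
    then obtain g where g: "\<exists>b\<in>pverts H. g b \<noteq> 0"
      "\<forall>a\<in>pverts H. (\<Sum>b\<in>pverts H. dist_mat H a b * g b) = k * g a"
      unfolding distance_spectrum[OF H.pair_finite_verts] by blast
    have "(\<Sum>v\<in>pverts G. dist_mat G u v * g (f v)) = k * g (f u)" if "u \<in> pverts G" for u
      using g(2)[unfolded sum_f] that f(2) by (simp add: dist)
    then show "k \<in> spectrum (distance_matrix G)"
      unfolding distance_spectrum[OF G.pair_finite_verts] using g(1) f(2)
      by (intro exI[of _ "\<lambda>v. g (f v)"]) auto
  next
    assume "k \<in> spectrum (distance_matrix G)"
    then obtain g where g: "\<exists>v\<in>pverts G. g v \<noteq> 0"
      "\<forall>u\<in>pverts G. (\<Sum>v\<in>pverts G. dist_mat G u v * g v) = k * g u"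
      unfolding distance_spectrum[OF G.pair_finite_verts] by blast
    define g' where "g' = (\<lambda>b. g (the_inv_into (pverts G) f b))"
    have g': "g' (f v) = g v" if "v \<in> pverts G" for v
      unfolding g'_def using the_inv_into_f_f[OF f(1) that] by simp
    have "(\<Sum>b\<in>pverts H. dist_mat H a b * g' b) = k * g' a" if a: "a \<in> pverts H" for a
    proof -
      obtain u where u: "a = f u" "u \<in> pverts G" using a f(2) by blast
      have "(\<Sum>b\<in>pverts H. dist_mat H a b * g' b) = (\<Sum>v\<in>pverts G. dist_mat G u v * g v)"
        unfolding sum_f using u by (intro sum.cong refl) (simp add: dist g')
      then show ?thesis using g(2) u g' by simp
    qed
    moreover have "\<exists>b\<in>pverts H. g' b \<noteq> 0" using g(1) g' f(2) by fastforce
    ultimately show "k \<in> spectrum (distance_matrix H)"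
      unfolding distance_spectrum[OF H.pair_finite_verts] by blast
  qed
  then show ?thesis unfolding distance_spectral_radius_def by (metis subsetI subset_antisym)
qed

section \<open>The structure and the spectral radius of the extremal graph\<close>

lemma pair_graph_complement:
  assumes "finite (pverts H)" "\<And>u v. (u, v) \<in> parcs H \<Longrightarrow> (v, u) \<in> parcs H"
  shows "pair_graph (graph_complement H)"
proof
  show "finite (parcs (graph_complement H))"
    by (rule finite_subset[of _ "pverts H \<times> pverts H"]) (use assms in \<open>auto simp: graph_complement_def\<close>)
  show "symmetric (with_proj (graph_complement H))"
    using assms(2) by (auto simp: symmetric_def sym_def graph_complement_def)
qed (use assms in \<open>auto simp: graph_complement_def\<close>)

text \<open>
  The complement of \<open>P\<^bsub>n,c\<^esub>\<close> consists of \<open>c1\<close> paths of order \<open>L\<close> and \<open>c2\<close> paths of order \<open>L'\<close>. If \<open>c\<close> divides \<open>n\<close>, then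
  there are no paths of the second kind.
\<close>

context
  fixes n c L L' c1 c2 :: nat
  assumes c: "1 \<le> c" "c \<le> n"
  defines "L \<equiv> n div c" and "L' \<equiv> nat \<lceil>real n / real c\<rceil>"
    and "c1 \<equiv> c + c * (n div c) - n" and "c2 \<equiv> n - c * (n div c)"
begin

lemma P_graph_verts: "pverts (P_graph n c) = ({..<c1} \<times> {..<L}) <+> ({..<c2} \<times> {..<L'})"
  by (simp add: P_graph_def graph_complement_def disjoint_union_def graph_copies_def path_graph_def
      L_def L'_def c1_def c2_def)

lemma pair_graph_P_graph: "pair_graph (P_graph n c)"
  unfolding P_graph_def
proof (rule pair_graph_complement)
  show "finite (pverts (disjoint_union (graph_copies (c + c * (n div c) - n) (path_graph (n div c)))
    (graph_copies (n - c * (n div c)) (path_graph (nat \<lceil>real n / real c\<rceil>)))))"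
    by (simp add: disjoint_union_def graph_copies_def path_graph_def)
qed (fastforce simp: disjoint_union_def graph_copies_def path_graph_def)

lemma non_nbrs_P_graph:
  "i < c1 \<Longrightarrow> u < L \<Longrightarrow> non_nbrs (P_graph n c) (Inl (i, u)) = (\<lambda>j. Inl (i, j)) ` path_nbrs L u"
  "i < c2 \<Longrightarrow> u < L' \<Longrightarrow> non_nbrs (P_graph n c) (Inr (i, u)) = (\<lambda>j. Inr (i, j)) ` path_nbrs L' u"
  by (force simp: P_graph_def graph_complement_def disjoint_union_def graph_copies_def path_graph_def
      non_nbrs_def path_nbrs_def L_def L'_def c1_def c2_def)+

lemma P_graph_block_counts: "c1 + c2 = c" "c1 * L + c2 * L' = n" "L \<ge> 1" "L' \<ge> 1" "c2 > 0 \<Longrightarrow> L' = Suc L"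
proof -
  have le: "c * L \<le> n" and less: "n < c + c * L"
    using c mult_div_mod_eq[of c n] mod_less_divisor[of c n] unfolding L_def by linarith+
  show 1: "c1 + c2 = c" using le less unfolding c1_def c2_def L_def[symmetric] by linarith
  show L: "L \<ge> 1" using c unfolding L_def by (simp add: Suc_le_eq div_greater_zero_iff)
  show L': "L' = Suc L" if "c2 > 0"
  proof -
    have "c * L < n" using that unfolding c2_def L_def by simp
    then have "real L < real n / real c" "real n / real c < real L + 1"
      using less c by (simp_all add: field_simps flip: of_nat_mult of_nat_add)
    then have "\<lceil>real n / real c\<rceil> = int (Suc L)" by (intro ceiling_unique) auto
    then show ?thesis by (simp add: L'_def)
  qed
  show "L' \<ge> 1"
  proof -
    have "real n / real c > 0" using c by simp
    then have "\<lceil>real n / real c\<rceil> \<ge> 1" by linarith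
    then show ?thesis unfolding L'_def by linarith
  qed
  show "c1 * L + c2 * L' = n"
  proof (cases "c2 = 0")
    case True
    then have "n = c * L" using le unfolding c2_def L_def by simp
    then show ?thesis using True 1 by simp
  next
    case False
    have "c1 * L + c2 * Suc L = (c1 + c2) * L + c2" by (simp add: algebra_simps)
    also have "\<dots> = n" unfolding 1 using le by (simp add: c2_def L_def)
    finally show ?thesis using False L' by simp
  qed
qed

text \<open>
  Non-adjacent vertices lie on the same path of the complement, and any vertex of another path is adjacent to both.
\<close>

lemma P_graph_diameter:
  assumes "2 \<le> c" and a: "a \<in> pverts (P_graph n c)" and b: "b \<in> non_nbrs (P_graph n c) a"
  shows "\<exists>w. (a, w) \<in> parcs (P_graph n c) \<and> (w, b) \<in> parcs (P_graph n c)"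
proof -
  interpret pair_graph "P_graph n c" by (rule pair_graph_P_graph)
  \<comment> \<open>The path of the complement on which a vertex lies.\<close>
  define comp where "comp = (\<lambda>v :: nat \<times> nat + nat \<times> nat. map_sum fst fst v)"
  have same: "comp v = comp u" if "u \<in> pverts (P_graph n c)" "v \<in> non_nbrs (P_graph n c) u" for u v
    using that non_nbrs_P_graph by (auto simp: comp_def P_graph_verts)
  define K where "K = {..<c1} <+> {..<c2}"
  have card_K: "card K = c" unfolding K_def using P_graph_block_counts(1) by (simp add: card_Plus)
  have "\<exists>k\<in>K. k \<noteq> comp a"
  proof (rule ccontr)
    assume "\<not> ?thesis"
    then have "K \<subseteq> {comp a}" by blast
    then have "card K \<le> 1" using card_mono[of "{comp a}" K] by simp
    then show False using card_K assms(1) by simp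
  qed
  then obtain k where k: "k \<in> K" "k \<noteq> comp a" by blast
  define w where "w = map_sum (\<lambda>i. (i, 0::nat)) (\<lambda>i. (i, 0::nat)) k"
  have w: "w \<in> pverts (P_graph n c)"
    using k(1) P_graph_block_counts(3,4) by (auto simp: w_def K_def P_graph_verts)
  have cw: "comp w = k" by (cases k) (auto simp: comp_def w_def)
  have arc: "(u, w) \<in> parcs (P_graph n c)" if "u \<in> pverts (P_graph n c)" "comp u = comp a" for u
    using same[OF that(1), of w] that w k cw by (auto simp: non_nbrs_def)
  have "b \<in> pverts (P_graph n c)" using b by (simp add: non_nbrs_def)
  then show ?thesis using arc[OF a refl] arc[of b] same[OF a b] arcs_sym by blast
qed

end

text \<open>
  The solution of \<open>(x - A) y = 1\<close> for the adjacency matrix \<open>A\<close> of the path on \<open>k\<close> vertices. The last branch is meant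
  for \<open>k = 4\<close>, the largest order that occurs.
\<close>

definition path_vec :: "nat \<Rightarrow> real \<Rightarrow> nat \<Rightarrow> real" where
  "path_vec k x i =
    (if k = 1 then 1 / x
     else if k = 2 then 1 / (x - 1)
     else if k = 3 then (if i = 1 then x + 2 else x + 1) / (x\<^sup>2 - 2)
     else (if i = 0 \<or> i = 3 then x else x + 1) / (x\<^sup>2 - x - 1))"

definition path_total :: "nat \<Rightarrow> real \<Rightarrow> real" where
  "path_total k x = (\<Sum>i<k. path_vec k x i)"

lemma path_total_simps:
  "path_total 1 x = 1 / x"
  "path_total 2 x = 2 / (x - 1)"
  "path_total 3 x = (3 * x + 4) / (x\<^sup>2 - 2)"
  "path_total 4 x = (4 * x + 2) / (x\<^sup>2 - x - 1)"
  by (simp_all add: path_total_def path_vec_def lessThan_nat_numeral add_divide_distrib[symmetric])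

lemma denominators_pos:
  fixes x :: real
  assumes "x \<ge> 3" shows "x\<^sup>2 - 2 > 0" "x\<^sup>2 - x - 1 > 0"
proof -
  have "3 * x \<le> x\<^sup>2" using assms by (simp add: power2_eq_square)
  then show "x\<^sup>2 - 2 > 0" "x\<^sup>2 - x - 1 > 0" using assms by linarith+
qed

lemma path_vec_pos: "x \<ge> 3 \<Longrightarrow> path_vec k x i > 0"
  using denominators_pos[of x] by (simp add: path_vec_def)

lemma path_vec_local:
  assumes x: "x \<ge> 3" and k: "1 \<le> k" "k \<le> 4" and i: "i < k"
  shows "x * path_vec k x i = 1 + (\<Sum>j\<in>path_nbrs k i. path_vec k x j)"
proof -
  note d = denominators_pos[OF x]
  have 1: "x * (1 / x) = 1" using x by simp
  have 2: "x * (1 / (x - 1)) = 1 + 1 / (x - 1)" using x by (simp add: divide_simps)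
  have 3: "x * ((x + 1) / (x\<^sup>2 - 2)) = 1 + (x + 2) / (x\<^sup>2 - 2)"
    "x * ((x + 2) / (x\<^sup>2 - 2)) = 1 + ((x + 1) / (x\<^sup>2 - 2) + (x + 1) / (x\<^sup>2 - 2))"
    using d(1) by (simp_all add: divide_simps, simp_all add: power2_eq_square algebra_simps)
  have 4: "x * (x / (x\<^sup>2 - x - 1)) = 1 + (x + 1) / (x\<^sup>2 - x - 1)"
    "x * ((x + 1) / (x\<^sup>2 - x - 1)) = 1 + (x / (x\<^sup>2 - x - 1) + (x + 1) / (x\<^sup>2 - x - 1))"
    using d(2) by (simp_all add: divide_simps, simp_all add: power2_eq_square algebra_simps)
  have "k = 1 \<or> k = 2 \<or> k = 3 \<or> k = 4" "i = 0 \<or> i = 1 \<or> i = 2 \<or> i = 3"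
    using k i by linarith+
  then show ?thesis
    using i 1 2 3 4
    by (elim disjE) (simp_all add: path_nbrs_eq path_vec_def insert_commute add.commute del: times_divide_eq_right)
qed

text \<open>
  These are the bounds \<open>1 / x\<close> and \<open>1 / (x - 2)\<close> on the entries, summed; they hold because path degrees lie between \<open>0\<close> and \<open>2\<close>.
  They locate the root of the secular equation.
\<close>

lemma path_total_bounds:
  assumes x: "x \<ge> 3" and k: "1 \<le> k" "k \<le> 4"
  shows "real k / x \<le> path_total k x" and "path_total k x \<le> real k / (x - 2)"
proof -
  note d = denominators_pos[OF x]
  have frac: "a / b \<le> p / q \<longleftrightarrow> a * q \<le> p * b" if "b > 0" "q > 0" for a b p q :: real
    using that by (simp add: field_simps)
  have 3: "3 / x \<le> (3 * x + 4) / (x\<^sup>2 - 2)" "(3 * x + 4) / (x\<^sup>2 - 2) \<le> 3 / (x - 2)"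
    using x d by (simp_all add: frac) (simp_all add: power2_eq_square algebra_simps)
  have 4: "4 / x \<le> (4 * x + 2) / (x\<^sup>2 - x - 1)" "(4 * x + 2) / (x\<^sup>2 - x - 1) \<le> 4 / (x - 2)"
    using x d by (simp_all add: frac) (simp_all add: power2_eq_square algebra_simps)
  have 1: "1 / x \<le> 1 / (x - 2)" "2 / x \<le> 2 / (x - 1)" "2 / (x - 1) \<le> 2 / (x - 2)"
    using x by (simp_all add: frac)
  have "k = 1 \<or> k = 2 \<or> k = 3 \<or> k = 4" using k by linarith
  then show "real k / x \<le> path_total k x" "path_total k x \<le> real k / (x - 2)"
    using 1 3 4 by (elim disjE; simp only: path_total_simps of_nat_numeral of_nat_1)+
qed

lemma isCont_path_total:
  assumes x: "x \<ge> 3" and k: "1 \<le> k" "k \<le> 4"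
  shows "isCont (path_total k) x"
proof -
  note d = denominators_pos[OF x]
  have "isCont (\<lambda>x. 1 / x) x" "isCont (\<lambda>x. 2 / (x - 1)) x" "isCont (\<lambda>x. (3 * x + 4) / (x\<^sup>2 - 2)) x"
    "isCont (\<lambda>x. (4 * x + 2) / (x\<^sup>2 - x - 1)) x"
    using x d by (intro continuous_intros; linarith)+
  then have "isCont (path_total 1) x" "isCont (path_total 2) x" "isCont (path_total 3) x" "isCont (path_total 4) x"
    unfolding path_total_simps[abs_def, symmetric] .
  moreover have "k = 1 \<or> k = 2 \<or> k = 3 \<or> k = 4" using k by linarith
  ultimately show ?thesis by (elim disjE) simp_all
qed

text \<open>
  At \<open>x = n\<close> the left side is at least \<open>1\<close> and at \<open>x = n + 2\<close> it is at most \<open>1\<close>.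
\<close>

lemma secular_root:
  fixes n a b k l :: nat
  assumes n: "n \<ge> 3" "a * k + b * l = n" and k: "1 \<le> k" "k \<le> 4" and l: "b > 0 \<Longrightarrow> 1 \<le> l \<and> l \<le> 4"
  obtains x where "real n \<le> x" "x \<le> real n + 2" "real a * path_total k x + real b * path_total l x = 1"
proof -
  \<comment> \<open>If \<open>b = 0\<close>, the order \<open>l\<close> is arbitrary and is replaced by one for which the bounds hold.\<close>
  define l' where "l' = (if b > 0 then l else 1)"
  have l': "1 \<le> l'" "l' \<le> 4" using l by (auto simp: l'_def)
  have sum: "real a * real k + real b * real l' = real n"
    using n(2) by (auto simp: l'_def simp flip: of_nat_mult of_nat_add)
  define f where "f = (\<lambda>x. real a * path_total k x + real b * path_total l' x)"
  have "real a * (real k / real n) + real b * (real l' / real n) \<le> f (real n)"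
    unfolding f_def using n path_total_bounds(1)[of "real n"] k l'
    by (intro add_mono mult_left_mono) auto
  also have "real a * (real k / real n) + real b * (real l' / real n) = (real a * real k + real b * real l') / real n"
    by (simp add: add_divide_distrib)
  finally have 1: "1 \<le> f (real n)" unfolding sum using n by simp
  have "f (real n + 2) \<le> real a * (real k / (real n + 2 - 2)) + real b * (real l' / (real n + 2 - 2))"
    unfolding f_def using n k l' by (intro add_mono mult_left_mono path_total_bounds(2)) auto
  also have "\<dots> = (real a * real k + real b * real l') / real n" by (simp add: add_divide_distrib)
  finally have 2: "f (real n + 2) \<le> 1" unfolding sum using n by simp
  have "isCont f x" if "real n \<le> x" for x
  proof -
    have "x \<ge> 3" using that n by linarith
    then show ?thesis unfolding f_def using isCont_path_total k l' by (intro continuous_intros) auto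
  qed
  then obtain x where x: "real n \<le> x" "x \<le> real n + 2" "f x = 1"
    using IVT2[of f "real n + 2" 1 "real n"] 1 2 by auto
  have "real b * path_total l' x = real b * path_total l x" by (auto simp: l'_def)
  then have "real a * path_total k x + real b * path_total l x = 1"
    using x(3) unfolding f_def by (simp only:)
  then show thesis by (rule that[OF x(1,2)])
qed

text \<open>
  The hypothesis is the eigenvalue equation for \<open>J + A\<close> with the adjacency matrix \<open>A\<close> of the complement. In
  diameter at most \<open>2\<close> the distance matrix is \<open>J - I + A\<close>.
\<close>

lemma (in pair_graph) distance_spectral_radius_diameter_2:
  assumes ne: "pverts G \<noteq> {}"
    and diam: "\<And>a b. a \<in> pverts G \<Longrightarrow> b \<in> non_nbrs G a \<Longrightarrow> \<exists>w. (a, w) \<in> parcs G \<and> (w, b) \<in> parcs G"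
    and pos: "\<And>v. v \<in> pverts G \<Longrightarrow> y v > 0"
    and eig: "\<And>u. u \<in> pverts G \<Longrightarrow> x * y u = (\<Sum>v\<in>pverts G. y v) + (\<Sum>v\<in>non_nbrs G u. y v)"
  shows "distance_spectral_radius G = x - 1"
proof (rule distance_spectral_radius_eqI[OF pair_finite_verts ne graph_dist_commute pos])
  fix u assume u: "u \<in> pverts G"
  have dist: "dist_mat G u v = 1 + (if v \<in> non_nbrs G u then 1 else 0) - (if v = u then 1 else 0)"
    if v: "v \<in> pverts G" for v
  proof -
    consider "u = v" | "(u, v) \<in> parcs G" | "u \<noteq> v" "(u, v) \<notin> parcs G" by blast
    then show ?thesis
    proof cases
      case 1
      then show ?thesis using u by (simp add: graph_dist_self non_nbrs_def)
    next
      case 2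
      then show ?thesis using pair_no_loops[OF 2] by (simp add: graph_dist_eq_1 non_nbrs_def)
    next
      case 3
      then have "v \<in> non_nbrs G u" using v by (simp add: non_nbrs_def)
      then show ?thesis using diam[OF u] graph_dist_eq_2 3 by fastforce
    qed
  qed
  have "(\<Sum>v\<in>pverts G. dist_mat G u v * y v) =
    (\<Sum>v\<in>pverts G. y v + (if v \<in> non_nbrs G u then y v else 0) - (if v = u then y v else 0))"
    by (intro sum.cong refl) (simp add: dist algebra_simps)
  also have "\<dots> = (\<Sum>v\<in>pverts G. y v) + (\<Sum>v\<in>pverts G. if v \<in> non_nbrs G u then y v else 0) - y u"
    using u pair_finite_verts by (simp add: sum.distrib sum_subtractf)
  also have "(\<Sum>v\<in>pverts G. if v \<in> non_nbrs G u then y v else 0) = (\<Sum>v\<in>{v\<in>pverts G. v \<in> non_nbrs G u}. y v)"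
    by (rule sum.inter_filter[OF pair_finite_verts, symmetric])
  also have "{v\<in>pverts G. v \<in> non_nbrs G u} = non_nbrs G u" by (auto simp: non_nbrs_def)
  finally show "(\<Sum>v\<in>pverts G. dist_mat G u v * y v) = (x - 1) * y u"
    using eig[OF u] by (simp add: algebra_simps)
qed

text \<open>
  The path solutions put together form a positive vector with entry sum \<open>1\<close>, by the secular equation, and hence an
  eigenvector.
\<close>

lemma distance_spectral_radius_P_graph:
  assumes c: "2 \<le> c" "c \<le> n" "n \<le> 4 * c" and x: "x \<ge> 3"
    and secular: "real (c + c * (n div c) - n) * path_total (n div c) x +
      real (n - c * (n div c)) * path_total (nat \<lceil>real n / real c\<rceil>) x = 1"
  shows "distance_spectral_radius (P_graph n c) = x - 1"
proof -
  define L where "L = n div c"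
  define L' where "L' = nat \<lceil>real n / real c\<rceil>"
  define c1 where "c1 = c + c * (n div c) - n"
  define c2 where "c2 = n - c * (n div c)"
  have c': "1 \<le> c" "c \<le> n" using c by auto
  note cc = P_graph_block_counts[OF c', folded L_def L'_def c1_def c2_def]
  note verts = P_graph_verts[OF c', folded L_def L'_def c1_def c2_def]
  note nbrs = non_nbrs_P_graph[OF c', folded L_def L'_def c1_def c2_def]
  interpret pair_graph "P_graph n c" by (rule pair_graph_P_graph[OF c'])
  have L4: "L \<le> 4"
  proof -
    have "L \<le> (4 * c) div c" unfolding L_def using c by (intro div_le_mono)
    then show ?thesis using c by simp
  qed
  have L'4: "L' \<le> 4"
  proof -
    have "real n \<le> 4 * real c" using c(3) by linarith
    then have "real n / real c \<le> 4" using c by (simp add: divide_le_eq)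
    then have "\<lceil>real n / real c\<rceil> \<le> 4" by (simp add: ceiling_le_iff)
    then show ?thesis unfolding L'_def by simp
  qed
  define y where "y = case_sum (\<lambda>(i::nat, u). path_vec L x u) (\<lambda>(i::nat, u). path_vec L' x u)"
  have total: "(\<Sum>v\<in>pverts (P_graph n c). y v) = 1"
    unfolding verts
    by (simp add: sum.Plus sum.cartesian_product[symmetric] y_def path_total_def[symmetric])
      (use secular in \<open>simp add: L_def L'_def c1_def c2_def\<close>)
  show ?thesis
  proof (rule distance_spectral_radius_diameter_2)
    show "pverts (P_graph n c) \<noteq> {}" using total by force
    show "\<exists>w. (a, w) \<in> parcs (P_graph n c) \<and> (w, b) \<in> parcs (P_graph n c)"
      if "a \<in> pverts (P_graph n c)" "b \<in> non_nbrs (P_graph n c) a" for a b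
      by (rule P_graph_diameter[OF c' c(1) that])
    show "y v > 0" for v using path_vec_pos[OF x] by (auto simp: y_def split: sum.splits)
    show "x * y u = (\<Sum>v\<in>pverts (P_graph n c). y v) + (\<Sum>v\<in>non_nbrs (P_graph n c) u. y v)"
      if "u \<in> pverts (P_graph n c)" for u
      unfolding total using that path_vec_local[OF x] cc(3,4) L4 L'4
      by (auto simp: verts nbrs y_def sum.reindex inj_on_def)
  qed
qed

section \<open>Recognising the extremal graph\<close>

text \<open>
  Two consecutive orders and the total determine how many lists of each length there are. If all lists have length
  \<open>k + 1\<close>, then \<open>n div c = k + 1\<close>, and otherwise \<open>n div c = k\<close>; this is why the two blocks are separated by
  comparison with \<open>n div c\<close> instead of \<open>k\<close>.
\<close>

lemma path_partition_block_counts: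
  fixes ps :: "'a list list" and k n :: nat
  assumes len: "\<forall>p\<in>set ps. length p \<in> {k, Suc k}" and ne: "ps \<noteq> []" and k: "k \<ge> 1"
    and n: "sum_list (map length ps) = n"
  defines "c \<equiv> length ps"
  defines "ps1 \<equiv> filter (\<lambda>p. length p = n div c) ps" and "ps2 \<equiv> filter (\<lambda>p. length p \<noteq> n div c) ps"
  shows "length ps1 = c + c * (n div c) - n" and "length ps2 = n - c * (n div c)"
    and "\<And>p. p \<in> set ps2 \<Longrightarrow> length p = nat \<lceil>real n / real c\<rceil>"
    and "c \<le> n"
proof -
  define b where "b = length (filter (\<lambda>p. length p \<noteq> k) ps)"
  have bc: "b \<le> c" unfolding b_def c_def by (rule length_filter_le)
  have nb: "n = c * k + b"
    using len unfolding n[symmetric] b_def c_def by (induction ps) auto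
  have ck: "c * k \<le> n" using nb by simp
  have c0: "c > 0" using ne by (simp add: c_def)
  have "c * 1 \<le> c * k" using k by (intro mult_le_mono2)
  then show "c \<le> n" using ck by linarith
  have part: "length ps1 + length ps2 = c"
    unfolding ps1_def ps2_def c_def using sum_length_filter_compl[of "\<lambda>p. length p = n div length ps" ps] by simp
  show "length ps1 = c + c * (n div c) - n" "length ps2 = n - c * (n div c)"
    "\<And>p. p \<in> set ps2 \<Longrightarrow> length p = nat \<lceil>real n / real c\<rceil>"
  proof -
    have "length ps2 = n - c * (n div c) \<and> (\<forall>p\<in>set ps2. length p = nat \<lceil>real n / real c\<rceil>)"
    proof (cases "b = c")
      case True
      then have q: "n div c = Suc k" using nb c0 by simp
      have "\<forall>p\<in>set ps. length p \<noteq> k"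
        using True length_filter_less[of _ ps "\<lambda>p. length p \<noteq> k"] unfolding b_def c_def by fastforce
      then have "ps2 = []" unfolding ps2_def q using len by (auto simp: filter_empty_conv)
      then show ?thesis using True nb q by simp
    next
      case False
      then have q: "n div c = k" using nb bc c0 by simp
      have len2: "length p = Suc k" if "p \<in> set ps2" for p using that len q by (auto simp: ps2_def)
      have "nat \<lceil>real n / real c\<rceil> = Suc k" if "p \<in> set ps2" for p
      proof -
        have "b > 0" using that q by (auto simp: b_def ps2_def filter_empty_conv)
        then have "real k < real n / real c" "real n / real c \<le> real k + 1"
          using nb bc c0 by (simp_all add: less_divide_eq divide_le_eq algebra_simps)
        then have "\<lceil>real n / real c\<rceil> = int (Suc k)" by (intro ceiling_unique) auto
        then show ?thesis by simp
      qed
      then have "\<forall>p\<in>set ps2. length p = nat \<lceil>real n / real c\<rceil>" using len2 by metis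
      moreover have "length ps2 = b" unfolding ps2_def b_def q ..
      moreover have "n - c * (n div c) = b" unfolding q using nb by simp
      ultimately show ?thesis by simp
    qed
    moreover have "c * (n div c) \<le> n" by simp
    ultimately show "length ps1 = c + c * (n div c) - n" "length ps2 = n - c * (n div c)"
      "\<And>p. p \<in> set ps2 \<Longrightarrow> length p = nat \<lceil>real n / real c\<rceil>"
      using part by (linarith, blast+)
  qed
qed

text \<open>
  The isomorphism sends position \<open>u\<close> of the \<open>i\<close>-th path of the complement of \<open>P\<^bsub>n,c\<^esub>\<close> to entry \<open>u\<close> of the \<open>i\<close>-th list
  of the same length. It is onto because the lists cover all vertices, and injective because the numbers of vertices agree.
\<close>

lemma (in pair_graph) iso_P_graph:
  fixes ps :: "'a list list" and k :: nat
  assumes ne: "ps \<noteq> []" and k: "k \<ge> 1"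
    and ps: "\<forall>p\<in>set ps. nbr_graph.path_component (pverts G) (non_nbrs G) p"
      "distinct (concat ps)" "set (concat ps) = pverts G"
    and len: "\<forall>p\<in>set ps. length p \<in> {k, Suc k}"
  shows "digraph_iso (with_proj G) (with_proj (P_graph (card (pverts G)) (length ps)))"
proof -
  interpret N: nbr_graph "pverts G" "non_nbrs G" by (rule nbr_graph_non_nbrs)
  define n where "n = card (pverts G)"
  define c where "c = length ps"
  have n: "sum_list (map length ps) = n" using N.walks1_path_partition(2)[OF ps] by (simp add: n_def)
  define L where "L = n div c"
  define L' where "L' = nat \<lceil>real n / real c\<rceil>"
  define c1 where "c1 = c + c * (n div c) - n"
  define c2 where "c2 = n - c * (n div c)"
  define ps1 where "ps1 = filter (\<lambda>p. length p = L) ps"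
  define ps2 where "ps2 = filter (\<lambda>p. length p \<noteq> L) ps"
  note counts = path_partition_block_counts[OF len ne k n, folded c_def, folded L_def, folded ps1_def ps2_def]
  have len1: "length ps1 = c1" and len2: "length ps2 = c2"
    using counts(1,2) by (simp_all add: c1_def c2_def L_def)
  have L1: "length (ps1 ! i) = L" if "i < c1" for i
    using nth_mem[of i ps1] that unfolding len1 by (auto simp: ps1_def)
  have L2: "length (ps2 ! i) = L'" if "i < c2" for i
    using nth_mem[of i ps2] that counts(3)[of "ps2 ! i"] unfolding len2 by (auto simp: L'_def)
  have c': "1 \<le> c" "c \<le> n" using ne counts(4) by (auto simp: c_def Suc_le_eq)
  let ?P = "P_graph n c"
  note cc = P_graph_block_counts[OF c', folded L_def L'_def c1_def c2_def]
  note verts = P_graph_verts[OF c', folded L_def L'_def c1_def c2_def]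
  note nbrs = non_nbrs_P_graph[OF c', folded L_def L'_def c1_def c2_def]
  define h where "h = case_sum (\<lambda>(i, u). ps1 ! i ! u) (\<lambda>(i, u). ps2 ! i ! u)"
  have comp1: "N.path_component (ps1 ! i)" if "i < c1" for i
    using nth_mem[of i ps1] that ps(1) unfolding len1 by (auto simp: ps1_def)
  have comp2: "N.path_component (ps2 ! i)" if "i < c2" for i
    using nth_mem[of i ps2] that ps(1) unfolding len2 by (auto simp: ps2_def)
  have mem1: "ps1 ! i ! u \<in> pverts G" if "i < c1" "u < L" for i u
    using comp1[OF that(1)] L1[OF that(1)] nth_mem[of u "ps1 ! i"] that(2)
    unfolding N.path_component_def by auto
  have mem2: "ps2 ! i ! u \<in> pverts G" if "i < c2" "u < L'" for i u
    using comp2[OF that(1)] L2[OF that(1)] nth_mem[of u "ps2 ! i"] that(2)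
    unfolding N.path_component_def by auto
  have surj: "h ` pverts ?P = pverts G"
  proof (intro subset_antisym subsetI)
    fix v assume "v \<in> h ` pverts ?P"
    then show "v \<in> pverts G"
      using mem1 mem2 by (auto simp: verts h_def)
  next
    fix v assume "v \<in> pverts G"
    then obtain p where p: "p \<in> set ps" "v \<in> set p" using ps(3) by auto
    obtain u where u: "u < length p" "p ! u = v" using p by (auto simp: in_set_conv_nth)
    show "v \<in> h ` pverts ?P"
    proof (cases "length p = L")
      case True
      then have "p \<in> set ps1" using p by (simp add: ps1_def)
      then obtain i where "i < c1" "ps1 ! i = p" by (auto simp: in_set_conv_nth len1)
      then show ?thesis using u True by (intro image_eqI[of _ _ "Inl (i, u)"]) (auto simp: h_def verts)
    next
      case False
      then have "p \<in> set ps2" using p by (simp add: ps2_def)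
      then obtain i where i: "i < c2" "ps2 ! i = p" by (auto simp: in_set_conv_nth len2)
      then show ?thesis using u L2[OF i(1)] by (intro image_eqI[of _ _ "Inr (i, u)"]) (auto simp: h_def verts)
    qed
  qed
  have "card (pverts ?P) = n" unfolding verts using cc(2) by (simp add: card_Plus)
  moreover have "finite (pverts ?P)" unfolding verts by simp
  ultimately have inj: "inj_on h (pverts ?P)"
    using surj by (intro eq_card_imp_inj_on) (simp_all add: n_def)
  have nb: "non_nbrs G (h a) = h ` non_nbrs ?P a" if a: "a \<in> pverts ?P" for a
    using a comp1 comp2 L1 L2
    by (auto simp: verts nbrs h_def N.path_component_def image_image)
  have P: "pair_graph ?P" by (rule pair_graph_P_graph[OF c'])
  have arc: "(h a, h b) \<in> parcs G \<longleftrightarrow> (a, b) \<in> parcs ?P" if ab: "a \<in> pverts ?P" "b \<in> pverts ?P" for a b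
  proof (cases "a = b")
    case True
    then show ?thesis using pair_no_loops[of "(h a, h a)"] pair_loopfree_digraph.pair_no_loops[of ?P "(a, a)"] P
      by (auto simp: pair_graph_def pair_digraph_def)
  next
    case False
    then have "h a \<noteq> h b" using inj ab by (auto dest: inj_onD)
    moreover have "h b \<in> pverts G" using surj ab by blast
    ultimately have "(h a, h b) \<in> parcs G \<longleftrightarrow> h b \<notin> h ` non_nbrs ?P a"
      unfolding nb[OF ab(1), symmetric] by (auto simp: non_nbrs_def)
    also have "\<dots> \<longleftrightarrow> b \<notin> non_nbrs ?P a"
      using inj ab by (subst inj_on_image_mem_iff[OF inj]) (auto simp: non_nbrs_def)
    also have "\<dots> \<longleftrightarrow> (a, b) \<in> parcs ?P" using False ab by (auto simp: non_nbrs_def)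
    finally show ?thesis .
  qed
  interpret P: pair_graph ?P by (rule P)
  define f where "f = the_inv_into (pverts ?P) h"
  have f: "f (h a) = a" if "a \<in> pverts ?P" for a unfolding f_def by (rule the_inv_into_f_f[OF inj that])
  have "inj_on f (pverts G)" unfolding surj[symmetric] by (auto simp: inj_on_def f)
  moreover have "pverts ?P = f ` pverts G" unfolding surj[symmetric] by (force simp: f image_image)
  moreover have "parcs ?P = (\<lambda>(u, v). (f u, f v)) ` parcs G"
  proof (intro subset_antisym subrelI)
    fix a b assume ab: "(a, b) \<in> parcs ?P"
    then have "a \<in> pverts ?P" "b \<in> pverts ?P" by (auto dest: P.in_arcsD1 P.in_arcsD2)
    then show "(a, b) \<in> (\<lambda>(u, v). (f u, f v)) ` parcs G"
      using ab arc f by (intro image_eqI[of _ _ "(h a, h b)"]) auto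
  next
    fix a b assume "(a, b) \<in> (\<lambda>(u, v). (f u, f v)) ` parcs G"
    then obtain u v where uv: "(u, v) \<in> parcs G" "a = f u" "b = f v" by auto
    obtain a' b' where "u = h a'" "v = h b'" "a' \<in> pverts ?P" "b' \<in> pverts ?P"
      using in_arcsD1[OF uv(1)] in_arcsD2[OF uv(1)] unfolding surj[symmetric] by blast
    then show "(a, b) \<in> parcs ?P" using uv f arc by simp
  qed
  ultimately show ?thesis
    unfolding digraph_iso_with_proj_iff[OF pair_wf_digraph_axioms] n_def c_def by blast
qed

section \<open>The comparison\<close>

text \<open>
  This rewrites the secular equation in terms of \<open>k\<close> and \<open>k + 1\<close> for any \<open>k\<close> with \<open>c k \<le> n \<le> c (k + 1)\<close>, so that the boundary
  cases \<open>n = 2 c\<close>, \<open>n = 3 c\<close> and \<open>n = 4 c\<close> need no separate treatment.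
\<close>

lemma secular_blocks:
  fixes g :: "nat \<Rightarrow> real"
  assumes c: "1 \<le> c" "c \<le> n" and k: "c * k \<le> n" "n \<le> c * Suc k"
  shows "real (c + c * (n div c) - n) * g (n div c) + real (n - c * (n div c)) * g (nat \<lceil>real n / real c\<rceil>) =
    (real c * (real k + 1) - real n) * g k + (real n - real c * real k) * g (Suc k)"
proof -
  note cc = P_graph_block_counts[OF c]
  show ?thesis
  proof (cases "n = c * Suc k")
    case True
    then have "n div c = Suc k" using c by simp
    then show ?thesis using True by (simp add: algebra_simps)
  next
    case False
    then have "n < c * Suc k" using k by simp
    then have q: "n div c = k"
      using k c by (intro div_nat_eqI) (auto simp: mult.commute)
    have c2: "real (n - c * k) = real n - real c * real k" using k by (simp add: of_nat_diff)
    have "n \<le> c + c * k" using k by simp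
    then have c1: "real (c + c * k - n) = real c + real c * real k - real n" by (simp add: of_nat_diff)
    have "real (n - c * k) * g (nat \<lceil>real n / real c\<rceil>) = real (n - c * k) * g (Suc k)"
      using cc(5) unfolding q by (cases "n - c * k = 0") auto
    then show ?thesis unfolding q by (simp add: c1 c2 algebra_simps)
  qed
qed

text \<open>
  The Rayleigh quotient of the all-ones vector: among all ordered pairs of distinct vertices, only the two orientations of each edge
  are at distance \<open>1\<close>.
\<close>

lemma (in pair_graph) distance_spectral_radius_ge_edge_count:
  assumes conn: "Digraph_Component.connected (with_proj G)"
  shows "2 * real (card (pverts G)) * (real (card (pverts G)) - 1) - 2 * real (card (edges G))
    \<le> distance_spectral_radius G * real (card (pverts G))"
proof -
  interpret N: nbr_graph "pverts G" "non_nbrs G" by (rule nbr_graph_non_nbrs)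
  have "(\<Sum>v\<in>pverts G. real (card (non_nbrs G v))) =
      real (card (pverts G)) * (real (card (pverts G)) - 1) - 2 * real (card (edges G))"
    using arg_cong[OF sum_card_non_nbrs, of real_of_int] by simp
  then show ?thesis
    using nonadjacency_quad_form_le[OF conn, of "\<lambda>_. 1"]
    unfolding N.quad_form_distance_lower[of _ 0] N.rayleigh_gap_def
    by (simp add: power2_eq_square algebra_simps)
qed

theorem theorem1p3:
  fixes m n s :: nat and G :: "'a pair_pre_digraph"
  assumes "m \<ge> 3"
    and "int n = \<lceil>(1 + sqrt (8 * real m)) / 2\<rceil>"
    and "int s = int m - int ((n - 1) choose 2)"
    and "pair_graph G" and "Digraph_Component.connected (with_proj G)"
    and "card (edges G) = m"
    and "max ((real n - 6) / 2) 1 \<le> real s" and "s \<le> n - 1"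
  shows "distance_spectral_radius G \<ge> distance_spectral_radius (P_graph n (s + 1)) \<and>
    (distance_spectral_radius G = distance_spectral_radius (P_graph n (s + 1)) \<longleftrightarrow>
      digraph_iso (with_proj G) (with_proj (P_graph n (s + 1))))"
proof -
  interpret pair_graph G by fact
  interpret N: nbr_graph "pverts G" "non_nbrs G" by (rule nbr_graph_non_nbrs)
  define c where "c = s + 1"
  have s1: "1 \<le> s" using assms(7) by simp
  have n0: "1 \<le> n" using s1 assms(8) by simp
  have c: "2 \<le> c" "c \<le> n" using s1 assms(8) n0 by (auto simp: c_def)
  have n_le: "n \<le> 2 * c + 4"
  proof -
    have "real n \<le> 2 * real s + 6" using assms(7) by (simp add: field_simps)
    then have "real n \<le> real (2 * s + 6)" by simp
    then have "n \<le> 2 * s + 6" by (simp only: of_nat_le_iff)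
    then show ?thesis by (simp add: c_def)
  qed
  have n4: "n \<le> 4 * c" using n_le c by linarith
  have "2 * ((n - 1) choose 2) = (n - 1) * (n - 1 - 1)"
    unfolding choose_two by (rule dvd_mult_div_cancel) (cases "n - 1", auto)
  then have "int (2 * ((n - 1) choose 2)) = int ((n - 1) * (n - 1 - 1))" by (rule arg_cong)
  then have "2 * int ((n - 1) choose 2) = (int n - 1) * (int n - 2)"
    using c by (simp add: of_nat_diff)
  then have m: "2 * int m = (int n - 1) * (int n - 2) + 2 * int s" using assms(3) by linarith
  have n3: "3 \<le> n"
  proof (rule ccontr)
    assume "\<not> ?thesis"
    then have "n = 2" using c by simp
    then show False using m assms(1,8) by simp
  qed
  have c': "1 \<le> c" using c by simp
  note cc = P_graph_block_counts[OF c' c(2)]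
  obtain x where x: "real n \<le> x" "x \<le> real n + 2"
    and sec: "real (c + c * (n div c) - n) * path_total (n div c) x +
      real (n - c * (n div c)) * path_total (nat \<lceil>real n / real c\<rceil>) x = 1"
  proof (rule secular_root[OF n3 cc(2) cc(3)])
    have "n div c \<le> (4 * c) div c" using n4 by (rule div_le_mono)
    then show 4: "n div c \<le> 4" using c by simp
    have "real n \<le> 4 * real c" using n4 by linarith
    then have "real n / real c \<le> 4" using c by (simp add: divide_le_eq)
    then have "\<lceil>real n / real c\<rceil> \<le> 4" by (simp add: ceiling_le_iff)
    then show "1 \<le> nat \<lceil>real n / real c\<rceil> \<and> nat \<lceil>real n / real c\<rceil> \<le> 4" using cc(4) by simp
  qed
  have x3: "3 \<le> x" using x n3 by simp
  have P: "distance_spectral_radius (P_graph n c) = x - 1"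
    by (rule distance_spectral_radius_P_graph[OF c n4 x3 sec])
  have iso_imp: "distance_spectral_radius G = x - 1" if "digraph_iso (with_proj G) (with_proj (P_graph n c))"
    unfolding P[symmetric]
    by (rule distance_spectral_radius_iso[OF assms(4) pair_graph_P_graph[OF c' c(2)] that P_graph_diameter[OF c' c(2) c(1)]])
  define n' where "n' = card (pverts G)"
  let ?\<rho> = "distance_spectral_radius G"
  have W: "N.walks1 = int n' * (int n' - 1) - 2 * int m"
    using sum_card_non_nbrs assms(6) by (simp add: N.walks1_def n'_def)
  have "0 \<le> N.walks1" unfolding N.walks1_def by (simp add: sum_nonneg)
  \<comment> \<open>With fewer than \<open>n\<close> vertices there are at most \<open>(n - 1) (n - 2) / 2 < m\<close> edges.\<close>
  have n'_ge: "n \<le> n'"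
  proof (rule ccontr)
    assume "\<not> ?thesis"
    then have "int n' * (int n' - 1) \<le> (int n - 1) * (int n - 2)"
      using c by (cases "n' = 0") (auto intro!: mult_mono)
    then show False using \<open>0 \<le> N.walks1\<close> W m s1 by linarith
  qed
  have "x - 1 < ?\<rho> \<or> digraph_iso (with_proj G) (with_proj (P_graph n c))"
  proof (cases "n' = n")
    case False
    have n'1: "real n + 1 \<le> real n'" using n'_ge False by linarith
    have "int s \<le> int n - 1" using assms(8) n3 by linarith
    then have "2 * int m \<le> (int n - 1) * (int n - 2) + 2 * (int n - 1)" unfolding m by simp
    also have "\<dots> = int n * (int n - 1)" by (simp add: algebra_simps)
    finally have "real_of_int (2 * int m) \<le> real_of_int (int n * (int n - 1))" by (simp only: of_int_le_iff)
    then have m_le: "2 * real m \<le> real n * (real n - 1)" by simp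
    have "(real n + 1) * (real n - 1) \<le> real n' * (2 * real n' - real n - 3)"
      using n'1 n3 by (intro mult_mono) auto
    then have "real n' * (real n + 1) < 2 * real n' * (real n' - 1) - 2 * real m"
      using m_le n3 by (simp add: algebra_simps)
    also have "\<dots> \<le> ?\<rho> * real n'"
      using distance_spectral_radius_ge_edge_count[OF assms(5)] by (simp add: n'_def assms(6))
    finally have "real n + 1 < ?\<rho>" by (simp add: mult.commute[of "real n'"] mult_less_cancel_right)
    then show ?thesis using x by simp
  next
    case True
    then have card: "card (pverts G) = n" by (simp add: n'_def)
    have w1: "N.walks1 = 2 * (int (card (pverts G)) - int c)"
      using W m unfolding card True c_def by (simp add: algebra_simps)
    then have w1': "real_of_int N.walks1 = 2 * (real (card (pverts G)) - real c)" by simp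
    have x': "real (card (pverts G)) \<le> x" using x card by simp
    have quad: "N.rayleigh_gap x y + (x - 1) * (\<Sum>v\<in>pverts G. (y v)\<^sup>2) \<le> ?\<rho> * (\<Sum>v\<in>pverts G. (y v)\<^sup>2)" for y
      using nonadjacency_quad_form_le[OF assms(5), of y] unfolding N.quad_form_distance_lower[of _ x] .
    have gap: "x - 1 < ?\<rho>" if "0 < N.rayleigh_gap x y" for y
    proof (rule ccontr)
      assume "\<not> ?thesis"
      then have "?\<rho> * (\<Sum>v\<in>pverts G. (y v)\<^sup>2) \<le> (x - 1) * (\<Sum>v\<in>pverts G. (y v)\<^sup>2)"
        by (intro mult_right_mono sum_nonneg) auto
      then show False using quad[of y] that by linarith
    qed
    have iso: "digraph_iso (with_proj G) (with_proj (P_graph n c))"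
      if part: "\<exists>ps. (\<forall>p\<in>set ps. N.path_component p \<and> length p \<in> {k, Suc k}) \<and>
        distinct (concat ps) \<and> set (concat ps) = pverts G" and "1 \<le> k" for k
    proof -
      obtain ps where ps: "\<forall>p\<in>set ps. N.path_component p" "distinct (concat ps)" "set (concat ps) = pverts G"
        and len: "\<forall>p\<in>set ps. length p \<in> {k, Suc k}" using part by blast
      have "length ps = c" using N.walks1_path_partition(1)[OF ps] w1 by simp
      moreover from this have "ps \<noteq> []" using c by auto
      ultimately show ?thesis using iso_P_graph[OF _ \<open>1 \<le> k\<close> ps len] card by simp
    qed
    \<comment> \<open>The extremal paths have orders \<open>1\<close> and \<open>2\<close>, or \<open>2\<close> and \<open>3\<close>, or \<open>3\<close> and \<open>4\<close>.\<close>
    consider "n \<le> 2 * c" | "2 * c \<le> n" "n \<le> 3 * c" | "3 * c \<le> n" by linarith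
    then show ?thesis
    proof cases
      case 1
      have "(2 * real c - real (card (pverts G))) * (1 / x) + (real (card (pverts G)) - real c) * (2 / (x - 1)) = 1"
        using sec secular_blocks[OF c' c(2), of 1 "\<lambda>k. path_total k x"] 1 c
        by (simp add: card path_total_simps[unfolded One_nat_def] numeral_2_eq_2[symmetric] mult.commute)
      then show ?thesis
        using N.degree_test_matchings[OF x3 w1'] gap N.path_partition_if_degree_le_1 iso[of 1] by blast
    next
      case 2
      have "(3 * real c - real (card (pverts G))) * (2 / (x - 1)) +
          (real (card (pverts G)) - 2 * real c) * ((3 * x + 4) / (x\<^sup>2 - 2)) = 1"
        using sec secular_blocks[OF c' c(2), of 2 "\<lambda>k. path_total k x"] 2 c
        by (simp add: card path_total_simps mult.commute)
      moreover have "2 * real c \<le> real (card (pverts G))" "real (card (pverts G)) \<le> 3 * real c"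
        using 2 by (simp_all add: card)
      ultimately show ?thesis
        using N.degree_test_P2_P3[OF x3 x' w1'] gap N.path_partition_if_degree_2_independent iso[of 2] by fastforce
    next
      case 3
      have sec': "(4 * real c - real (card (pverts G))) * ((3 * x + 4) / (x\<^sup>2 - 2)) +
          (real (card (pverts G)) - 3 * real c) * ((4 * x + 2) / (x\<^sup>2 - x - 1)) = 1"
        using sec secular_blocks[OF c' c(2), of 3 "\<lambda>k. path_total k x"] 3 n4 c
        by (simp add: card path_total_simps mult.commute)
      have b: "3 * real c \<le> real (card (pverts G))" "real (card (pverts G)) \<le> 4 * real c"
        using 3 n4 by (simp_all add: card)
      show ?thesis
      proof (rule ccontr)
        assume contra: "\<not> ?thesis"
        then have d: "\<forall>v\<in>pverts G. N.deg v \<in> {1, 2} \<and> (\<forall>u\<in>non_nbrs G v. \<not> (N.deg v = 1 \<and> N.deg u = 1))"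
          and gap0: "card (pverts G) = 4 * c \<Longrightarrow> 0 \<le> N.rayleigh_gap x (\<lambda>v. x - 1 + real (N.deg v))"
          using N.degree_test_P3_P4[OF x3 x' w1' b sec'] gap by fastforce+
        have "u = w" if v: "v \<in> pverts G" "N.deg v = 2" and u: "u \<in> non_nbrs G v" "N.deg u = 2"
          and w: "w \<in> non_nbrs G v" "N.deg w = 2" for v u w
        proof (rule ccontr)
          assume ne: "u \<noteq> w"
          have "4 \<le> 3 * (2 * (int n - int c)) - 4 * int n"
            using N.adjacent_degree_2_count[OF d v u w ne] unfolding w1 card .
          then have n_ge: "3 * c + 2 \<le> n" by presburger
          \<comment> \<open>Together with \<open>n \<le> 2 c + 4\<close> only \<open>n = 8\<close>, \<open>c = 2\<close> is left.\<close>
          then have "c = 2" using n_le c by linarith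
          then have n_eq: "card (pverts G) = 4 * c" using n_ge n_le card by linarith
          have "4 * real c - real (card (pverts G)) = 0" "real (card (pverts G)) - 3 * real c = real c"
            unfolding n_eq by simp_all
          then have secular: "real c * ((4 * x + 2) / (x\<^sup>2 - x - 1)) = 1"
            using sec' by (simp only: mult_zero_left add_0)
          have "quad_form (pverts G) (truncated_dist (non_nbrs G)) y
            \<le> (x - 1) * (\<Sum>v\<in>pverts G. (y v)\<^sup>2)" for y
          proof -
            have "?\<rho> * (\<Sum>v\<in>pverts G. (y v)\<^sup>2) \<le> (x - 1) * (\<Sum>v\<in>pverts G. (y v)\<^sup>2)"
              using contra by (intro mult_right_mono sum_nonneg) auto
            then show ?thesis using nonadjacency_quad_form_le[OF assms(5), of y] by linarith
          qed
          then have "u = w"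
            by (rule N.P4_degree_vector_eigen[OF d w1 n_eq secular gap0[OF n_eq] _ v u w])
          then show False using ne by simp
        qed
        then have "digraph_iso (with_proj G) (with_proj (P_graph n c))"
          by (intro iso[of 3] N.path_partition_if_leaves_independent[OF d]) auto
        then show False using contra by simp
      qed
    qed
  qed
  then show ?thesis using iso_imp P unfolding c_def by fastforce
qed

end
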